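(* Let $\mathring\Phi=(A,B)$ be the Ernst potential of the axial Killing vector-field $\mathbf Z$ of the Kerr spacetime $\mathcal K(M,a)$, $|a|\le M$, with metric $\mathbf g$. The linearized equations $$\square\phi+2\frac{\mathbf D^\mu B}{A}\mathbf D_\mu\psi-2\frac{\mathbf D^\mu B\,\mathbf D_\mu B}{A^2}\phi+2\frac{\mathbf D^\mu B\,\mathbf D_\mu A}{A^2}\psi=0,$$ $$\square\psi-2\frac{\mathbf D^\mu B}{A}\mathbf D_\mu\phi-\frac{\mathbf D^\mu A\,\mathbf D_\mu A+\mathbf D^\mu B\,\mathbf D_\mu B}{A^2}\psi=0$$ (for axially symmetric solutions $\Psi=(\phi,\psi)$, i.e. $\mathbf Z(\phi)=\mathbf Z(\psi)=0$) admit an energy-momentum tensor type quantity $\mathcal Q_{\mu\nu}=\mathcal Q[\Psi]_{\mu\nu}$ and a source $\mathcal J_\nu$, both quadratic in $(\Psi,\partial\Psi)$, depending also on $(\mathring\Phi,\partial\mathring\Phi)$, verifying the following: (a) $\mathcal Q(X,Y)>0$ for any future-oriented, timelike vector-fields $X,Y$; (b) $\mathbf D^\nu\mathcal Q_{\mu\nu}=\mathcal J_\mu$; (c) $\mathbf g(\mathbf T,\mathcal J)=0$; (d) $\mathcal Q(\mathbf Z,X)=0$ for any vector-field $X$ orthogonal to $\mathbf Z$.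
   Context: The Kerr metric of $\mathcal K(M,a)$ in Boyer--Lindquist coordinates $(\theta,r,t,\varphi)$, on the domain of outer communication $r>M+\sqrt{M^2-a^2}$, is $$\mathbf g=-\frac{q^2\Delta}{\Sigma^2}dt^2+\frac{\Sigma^2(\sin\theta)^2}{q^2}\Big(d\varphi-\frac{2aMr}{\Sigma^2}dt\Big)^2+\frac{q^2}{\Delta}dr^2+q^2d\theta^2,$$ with $\Delta=r^2+a^2-2Mr$, $q^2=r^2+a^2(\cos\theta)^2$, $\Sigma^2=(r^2+a^2)^2-a^2(\sin\theta)^2\Delta$. The vector-fields $\mathbf T=\partial_t$ and $\mathbf Z=\partial_\varphi$ are Killing. $\mathbf D$ is the Levi-Civita connection of $\mathbf g$, indices are raised and lowered with $\mathbf g$, and $\square=\mathbf D^\mu\mathbf D_\mu$ is the wave operator of $\mathbf g$; $\mathbf g(\mathbf T,\mathcal J)$ means $\mathbf T^\mu\mathcal J_\mu$. The Ernst potential associated to $\mathbf Z$ is $\mathring\Phi=(A,B)$ with $$A=\mathbf g(\mathbf Z,\mathbf Z)=\frac{\Sigma^2(\sin\theta)^2}{q^2},\qquad B=-\Big[2aM(3\cos\theta-(\cos\theta)^3)+\frac{2a^3M(\sin\theta)^4\cos\theta}{q^2}\Big].$$ It is a stationary, axisymmetric solution of the wave map system $X\square X=\mathbf D^\mu X\mathbf D_\mu X-\mathbf D^\mu Y\mathbf D_\mu Y$, $X\square Y=2\mathbf D^\mu X\mathbf D_\mu Y$ (maps $(X,Y)$ into the hyperbolic plane). The linearized equations are the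 linearization in $\Psi=(\phi,\psi)$ at $\Psi=0$ of this system for maps of the form $\mathring\Phi+A\Psi$.
   Formalization: In (a), Q(X,Y)>0 is claimed at points where (Ψ,∂Ψ) is nonzero, since a quadratic Q vanishes where (Ψ,∂Ψ)=0; the axis, where A=0 and the equations are undefined, is excluded. *)

theory Defs
  imports "HOL-Analysis.Analysis"
begin

section \<open>Tensor calculus in a coordinate chart of a 4-manifold\<close>

text \<open>
  Points, tangent vectors and covectors are given by their coordinates in \<^typ>\<open>real^4\<close>; a metric
  is a matrix-valued function of the point. Two-tensors are represented by their covariant
  components.
\<close>

definition pd :: "4 \<Rightarrow> (real^4 \<Rightarrow> real) \<Rightarrow> real^4 \<Rightarrow> real" where
  "pd i f x = frechet_derivative f (at x) (axis i 1)"

definition differential :: "(real^4 \<Rightarrow> real) \<Rightarrow> real^4 \<Rightarrow> real^4" where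
  "differential f x = (\<chi> i. pd i f x)"

definition C2_on :: "(real^4) set \<Rightarrow> (real^4 \<Rightarrow> real) \<Rightarrow> bool" where
  "C2_on U f \<longleftrightarrow>
     (\<forall>x\<in>U. f differentiable (at x)) \<and>
     (\<forall>i. \<forall>x\<in>U. pd i f differentiable (at x)) \<and>
     (\<forall>i j. continuous_on U (pd i (pd j f)))"

definition christoffel :: "(real^4 \<Rightarrow> real^4^4) \<Rightarrow> real^4 \<Rightarrow> 4 \<Rightarrow> 4 \<Rightarrow> 4 \<Rightarrow> real" where
  "christoffel G x k i j =
     (\<Sum>l\<in>UNIV. matrix_inv (G x) $ k $ l *
        (pd i (\<lambda>y. G y $ j $ l) x + pd j (\<lambda>y. G y $ i $ l) x - pd l (\<lambda>y. G y $ i $ j) x)) / 2"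

definition covector_inner :: "(real^4 \<Rightarrow> real^4^4) \<Rightarrow> real^4 \<Rightarrow> real^4 \<Rightarrow> real^4 \<Rightarrow> real" where
  "covector_inner G x v w = (\<Sum>i\<in>UNIV. \<Sum>j\<in>UNIV. matrix_inv (G x) $ i $ j * v $ i * w $ j)"

text \<open>\<open>cov_deriv1 G w x i j\<close> is \<open>D\<^sub>i w\<^sub>j\<close> and \<open>cov_deriv2 G Q x k i j\<close> is \<open>D\<^sub>k Q\<^sub>i\<^sub>j\<close>.\<close>

definition cov_deriv1 :: "(real^4 \<Rightarrow> real^4^4) \<Rightarrow> (real^4 \<Rightarrow> real^4) \<Rightarrow> real^4 \<Rightarrow> 4 \<Rightarrow> 4 \<Rightarrow> real" where
  "cov_deriv1 G w x i j =
     pd i (\<lambda>y. w y $ j) x - (\<Sum>k\<in>UNIV. christoffel G x k i j * w x $ k)"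

definition cov_deriv2 :: "(real^4 \<Rightarrow> real^4^4) \<Rightarrow> (real^4 \<Rightarrow> real^4^4) \<Rightarrow> real^4 \<Rightarrow> 4 \<Rightarrow> 4 \<Rightarrow> 4 \<Rightarrow> real" where
  "cov_deriv2 G Q x k i j =
     pd k (\<lambda>y. Q y $ i $ j) x
       - (\<Sum>l\<in>UNIV. christoffel G x l k i * Q x $ l $ j)
       - (\<Sum>l\<in>UNIV. christoffel G x l k j * Q x $ i $ l)"

definition wave_op :: "(real^4 \<Rightarrow> real^4^4) \<Rightarrow> (real^4 \<Rightarrow> real) \<Rightarrow> real^4 \<Rightarrow> real" where
  "wave_op G f x =
     (\<Sum>i\<in>UNIV. \<Sum>j\<in>UNIV. matrix_inv (G x) $ i $ j * cov_deriv1 G (differential f) x i j)"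

text \<open>The covector \<open>\<mu> \<mapsto> D\<^sup>\<nu> Q\<^sub>\<mu>\<^sub>\<nu>\<close>.\<close>

definition divergence :: "(real^4 \<Rightarrow> real^4^4) \<Rightarrow> (real^4 \<Rightarrow> real^4^4) \<Rightarrow> real^4 \<Rightarrow> real^4" where
  "divergence G Q x =
     (\<chi> m. \<Sum>k\<in>UNIV. \<Sum>n\<in>UNIV. matrix_inv (G x) $ k $ n * cov_deriv2 G Q x k m n)"

type_synonym jet = "(real \<times> real) \<times> ((real^4) \<times> (real^4))"

definition jet1 :: "(real^4 \<Rightarrow> real) \<Rightarrow> (real^4 \<Rightarrow> real) \<Rightarrow> real^4 \<Rightarrow> jet" where
  "jet1 f h x = ((f x, h x), (differential f x, differential h x))"

definition quadratic :: "('a::real_vector \<Rightarrow> 'b::real_vector) \<Rightarrow> bool" where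
  "quadratic q \<longleftrightarrow> (\<exists>b. bilinear b \<and> (\<forall>v. q v = b v v))"


section \<open>The Kerr exterior in Boyer--Lindquist coordinates\<close>

text \<open>
  The coordinates of \<open>x\<close> are \<open>x $ 1 = \<theta>\<close>, \<open>x $ 2 = r\<close>, \<open>x $ 3 = t\<close>, \<open>x $ 4 = \<phi>\<close>. The angle
  \<open>\<phi>\<close> is unwrapped to the real line, so functions on the spacetime are the ones which are
  periodic in \<open>x $ 4\<close>.
\<close>

definition kerr_Delta :: "real \<Rightarrow> real \<Rightarrow> real^4 \<Rightarrow> real" where
  "kerr_Delta M a x = (x $ 2)\<^sup>2 + a\<^sup>2 - 2 * M * x $ 2"

definition kerr_qq :: "real \<Rightarrow> real^4 \<Rightarrow> real" where
  "kerr_qq a x = (x $ 2)\<^sup>2 + a\<^sup>2 * (cos (x $ 1))\<^sup>2"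

definition kerr_SS :: "real \<Rightarrow> real \<Rightarrow> real^4 \<Rightarrow> real" where
  "kerr_SS M a x = ((x $ 2)\<^sup>2 + a\<^sup>2)\<^sup>2 - a\<^sup>2 * (sin (x $ 1))\<^sup>2 * kerr_Delta M a x"

definition kerr_form :: "real \<Rightarrow> real \<Rightarrow> real^4 \<Rightarrow> real^4 \<Rightarrow> real^4 \<Rightarrow> real" where
  "kerr_form M a x X Y =
     (let D = kerr_Delta M a x; qq = kerr_qq a x; SS = kerr_SS M a x;
          w = 2 * a * M * x $ 2 / SS
      in - (qq * D / SS) * (X $ 3 * Y $ 3)
         + SS * (sin (x $ 1))\<^sup>2 / qq * ((X $ 4 - w * X $ 3) * (Y $ 4 - w * Y $ 3))
         + qq / D * (X $ 2 * Y $ 2)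
         + qq * (X $ 1 * Y $ 1))"

definition kerr_metric :: "real \<Rightarrow> real \<Rightarrow> real^4 \<Rightarrow> real^4^4" where
  "kerr_metric M a x = (\<chi> i j. kerr_form M a x (axis i 1) (axis j 1))"

text \<open>
  The domain of outer communication without the axis \<open>sin \<theta> = 0\<close>, where \<open>A = 0\<close> and the
  linearized equations are singular.
\<close>

definition kerr_exterior :: "real \<Rightarrow> real \<Rightarrow> (real^4) set" where
  "kerr_exterior M a = {x. M + sqrt (M\<^sup>2 - a\<^sup>2) < x $ 2 \<and> 0 < x $ 1 \<and> x $ 1 < pi}"

definition T_vec :: "real^4" where "T_vec = axis 3 1"

definition Z_vec :: "real^4" where "Z_vec = axis 4 1"

text \<open>
  The level sets of \<open>t\<close> are spacelike in the exterior, and time is oriented so that \<open>t\<close>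
  increases to the future. (\<open>T\<close> itself is not timelike in the ergoregion.)
\<close>

definition future_timelike :: "real \<Rightarrow> real \<Rightarrow> real^4 \<Rightarrow> real^4 \<Rightarrow> bool" where
  "future_timelike M a x X \<longleftrightarrow> kerr_form M a x X X < 0 \<and> X $ 3 > 0"

definition ernst_A :: "real \<Rightarrow> real \<Rightarrow> real^4 \<Rightarrow> real" where
  "ernst_A M a x = kerr_form M a x Z_vec Z_vec"

lemma ernst_A_eq: "ernst_A M a x = kerr_SS M a x * (sin (x $ 1))\<^sup>2 / kerr_qq a x"
  by (simp add: ernst_A_def kerr_form_def Z_vec_def axis_def Let_def)

definition ernst_B :: "real \<Rightarrow> real \<Rightarrow> real^4 \<Rightarrow> real" where
  "ernst_B M a x =
     - (2 * a * M * (3 * cos (x $ 1) - (cos (x $ 1)) ^ 3)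
        + 2 * a ^ 3 * M * (sin (x $ 1)) ^ 4 * cos (x $ 1) / kerr_qq a x)"

definition linearized_equations ::
  "(real^4 \<Rightarrow> real^4^4) \<Rightarrow> (real^4 \<Rightarrow> real) \<Rightarrow> (real^4 \<Rightarrow> real) \<Rightarrow>
   (real^4 \<Rightarrow> real) \<Rightarrow> (real^4 \<Rightarrow> real) \<Rightarrow> real^4 \<Rightarrow> bool" where
  "linearized_equations G A B \<phi> \<psi> x \<longleftrightarrow>
     (let ip = (\<lambda>f h. covector_inner G x (differential f x) (differential h x))
      in wave_op G \<phi> x + 2 * ip B \<psi> / A x
           - 2 * (ip B B / (A x)\<^sup>2) * \<phi> x + 2 * (ip B A / (A x)\<^sup>2) * \<psi> x = 0
         \<and> wave_op G \<psi> x - 2 * ip B \<phi> / A x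
           - (ip A A + ip B B) / (A x)\<^sup>2 * \<psi> x = 0)"

definition axisymmetric_solution ::
  "real \<Rightarrow> real \<Rightarrow> (real^4) set \<Rightarrow> (real^4 \<Rightarrow> real) \<Rightarrow> (real^4 \<Rightarrow> real) \<Rightarrow> bool" where
  "axisymmetric_solution M a U \<phi> \<psi> \<longleftrightarrow>
     C2_on U \<phi> \<and> C2_on U \<psi> \<and>
     (\<forall>x\<in>U. Z_vec \<bullet> differential \<phi> x = 0 \<and> Z_vec \<bullet> differential \<psi> x = 0 \<and>
        linearized_equations (kerr_metric M a) (ernst_A M a) (ernst_B M a) \<phi> \<psi> x)"

end

theory Submission
  imports Defs
begin

text \<open>
  Write \<open>C = dB / A\<close> and \<open>D = dA / A\<close>. The linearized equations are the Euler--Lagrange equations of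
  \<open>|E0|\<^sup>2 + |F0|\<^sup>2 + |N|\<^sup>2\<close>, where \<open>E0 = d\<phi> + \<psi> C\<close>, \<open>F0 = d\<psi> - \<phi> C\<close>, \<open>N = \<phi> C - \<psi> D\<close>, and the sum
  of the tensors \<open>V \<otimes> V - g |V|\<^sup>2 / 2\<close> over these three one-forms is the natural candidate for \<open>Q\<close>.
  It is only nonnegative: for \<open>a = 0\<close> one has \<open>B = 0\<close>, and the three forms vanish when \<open>\<phi>\<close> is a nonzero
  constant and \<open>\<psi> = 0\<close>.

  Strict positivity comes from a Hardy inequality. Let \<open>K = d (ln h)\<close> for a positive function \<open>h\<close>, and put
  \<open>E = E0 - \<phi> K\<close>, \<open>F = F0 - \<psi> K\<close>. Then
  \<open>|E0|\<^sup>2 + |F0|\<^sup>2 = |E|\<^sup>2 + |F|\<^sup>2 - (div K + |K|\<^sup>2) (\<phi>\<^sup>2 + \<psi>\<^sup>2) + div ((\<phi>\<^sup>2 + \<psi>\<^sup>2) K)\<close>.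
  The divergence does not affect the field equations, and \<open>- (div K + |K|\<^sup>2) = - (\<box>h) / h\<close> is positive when
  \<open>h\<close> is strictly superharmonic. With \<open>\<rho> = r - M\<close> and \<open>b\<^sup>2 = M\<^sup>2 - a\<^sup>2\<close>, so that \<open>\<Delta> = \<rho>\<^sup>2 - b\<^sup>2\<close>, the choice
  \<open>h = \<rho>\<close> to the power \<open>-1/2\<close> gives \<open>- (\<box>h) / h = (\<rho>\<^sup>2 + 3 b\<^sup>2) / (4 \<rho>\<^sup>2 q\<^sup>2) > 0\<close>. This function is written as
  \<open>|S|\<^sup>2\<close> with \<open>S\<close> a multiple of \<open>dr\<close> depending on \<open>r\<close> alone, so that the zeroth order term of the
  energy also consists of squares of one-forms, \<open>\<phi> S\<close> and \<open>\<psi> S\<close>. The tensor \<open>Q\<close> is the sum of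
  \<open>V \<otimes> V - g |V|\<^sup>2 / 2\<close> over the five one-forms \<open>E, F, N, \<phi> S, \<psi> S\<close>; both \<open>K\<close> and \<open>S\<close> are functions of the
  metric components, because \<open>\<Delta>\<close> is the quotient of the \<open>\<theta>\<theta>\<close> and \<open>rr\<close> components.

  The four properties follow. For (a), each summand satisfies the dominant energy condition strictly
  when its one-form is not zero (\<open>lorentz_dominant_energy\<close>, \<open>stress_kerr_positive\<close>), and the five forms
  vanish together only if \<open>\<Psi>\<close> does. For (b), the divergence of \<open>V \<otimes> V - g |V|\<^sup>2 / 2\<close> is
  \<open>(div V) V\<close> plus the contraction of \<open>dV\<close> with \<open>V\<close> (\<open>divergence_stress\<close>); for solutions of the linearized
  equations \<open>div V\<close> and \<open>dV\<close> are linear in the first jet of \<open>\<Psi>\<close>, since second derivatives of \<open>\<phi>\<close> and \<open>\<psi>\<close>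
  occur only through the wave operator and those of \<open>A\<close> and \<open>B\<close> are removed by the wave map equations
  (\<open>ernst_wave_map\<close>, \<open>divergence_energy_tensor\<close>). For (c), the background forms \<open>C, D, K, S\<close> annihilate the
  stationary direction, which reduces the claim to the identity \<open>div K + |K|\<^sup>2 + |S|\<^sup>2 = 0\<close>
  (\<open>energy_source_orthogonal\<close>, \<open>hardy_riccati\<close>). For (d), all five one-forms annihilate \<open>Z\<close>.
\<close>

section \<open>Partial derivatives in a chart\<close>

lemma pd_eqI: "(f has_derivative f') (at x) \<Longrightarrow> pd i f x = f' (axis i 1)"
  by (metis frechet_derivative_at pd_def)

lemma has_derivative_pd:
  assumes "f differentiable (at x)"
  shows "(f has_derivative (\<lambda>h. frechet_derivative f (at x) h)) (at x)"
  using assms frechet_derivative_works by auto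

lemma pd_add: "f differentiable (at x) \<Longrightarrow> g differentiable (at x) \<Longrightarrow>
    pd i (\<lambda>y. f y + g y) x = pd i f x + pd i g x"
  using pd_eqI[OF has_derivative_add[OF has_derivative_pd has_derivative_pd]] by (simp add: pd_def)

lemma pd_diff: "f differentiable (at x) \<Longrightarrow> g differentiable (at x) \<Longrightarrow>
    pd i (\<lambda>y. f y - g y) x = pd i f x - pd i g x"
  using pd_eqI[OF has_derivative_diff[OF has_derivative_pd has_derivative_pd]] by (simp add: pd_def)

lemma pd_mult: "f differentiable (at x) \<Longrightarrow> g differentiable (at x) \<Longrightarrow>
    pd i (\<lambda>y. f y * g y) x = pd i f x * g x + f x * pd i g x"
  using pd_eqI[OF has_derivative_mult[OF has_derivative_pd has_derivative_pd]]
  by (simp add: pd_def)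

lemma pd_const [simp]: "pd i (\<lambda>y. c) x = 0"
  using pd_eqI[OF has_derivative_const] by auto

lemma pd_sum:
  assumes "\<And>n. n \<in> N \<Longrightarrow> f n differentiable (at x)"
  shows "pd i (\<lambda>y. \<Sum>n\<in>N. f n y) x = (\<Sum>n\<in>N. pd i (f n) x)"
  using pd_eqI[OF has_derivative_sum[of N f, OF has_derivative_pd[OF assms]]]
  by (simp add: pd_def)

lemma pd_cong:
  assumes "eventually (\<lambda>y. f y = g y) (nhds x)"
  shows "pd i f x = pd i g x"
proof -
  obtain S where S: "open S" "x \<in> S" "\<And>y. y \<in> S \<Longrightarrow> f y = g y"
    using assms unfolding eventually_nhds by auto
  have "(f has_derivative f') (at x) \<longleftrightarrow> (g has_derivative f') (at x)" for f'
    using has_derivative_transform_within_open[OF _ S(1,2)] S(3) by metis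
  then show ?thesis by (simp add: pd_def frechet_derivative_def)
qed

lemma differentiable_cong_nhds:
  assumes "eventually (\<lambda>y. f y = g y) (nhds x)" "f differentiable (at x)"
  shows "g differentiable (at x)"
proof -
  obtain S where S: "open S" "x \<in> S" "\<And>y. y \<in> S \<Longrightarrow> f y = g y"
    using assms unfolding eventually_nhds by auto
  then show ?thesis
    using assms(2) has_derivative_transform_within_open[OF _ S(1,2)] unfolding differentiable_def by metis
qed

lemma differentiable_vec_nth: "f differentiable F \<Longrightarrow> (\<lambda>y. f y $ i) differentiable F"
  unfolding differentiable_def using bounded_linear.has_derivative[OF bounded_linear_vec_nth] by blast

lemma differentiable_vecI:
  fixes f :: "'a::euclidean_space \<Rightarrow> 'b::real_normed_vector ^ 'n"
  assumes "\<And>i. (\<lambda>y. f y $ i) differentiable (at x)"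
  shows "f differentiable (at x)"
proof -
  from assms obtain f' where f': "\<And>i. ((\<lambda>y. f y $ i) has_derivative f' i) (at x)"
    unfolding differentiable_def by metis
  have "(f has_derivative (\<lambda>h. \<chi> i. f' i h)) (at x)"
    unfolding has_derivative_def
  proof (intro conjI)
    show "bounded_linear (\<lambda>h. \<chi> i. f' i h)"
    proof -
      have l: "linear (f' i)" for i
        using has_derivative_linear[OF f'] .
      have "linear (\<lambda>h. \<chi> i. f' i h)"
        by (intro linearI) (simp_all add: vec_eq_iff linear_add[OF l] linear_cmul[OF l])
      then show ?thesis by (simp add: linear_conv_bounded_linear)
    qed
    show "((\<lambda>y. ((f y - f (netlimit (at x))) - (\<chi> i. f' i (y - netlimit (at x)))) /\<^sub>R norm (y - netlimit (at x))) \<longlongrightarrow> 0) (at x)"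
      using f' unfolding has_derivative_def by (intro vec_tendstoI) simp
  qed
  then show ?thesis unfolding differentiable_def by blast
qed

text \<open>
  Both mixed partial derivatives are the limit of the same symmetric second difference quotient: by the
  mean value theorem in direction \<open>i\<close> it is a difference of values of \<open>pd i f\<close>, which the derivative of
  \<open>pd i f\<close> at \<open>x\<close> approximates. The lemma makes differentials closed.
\<close>

lemma pd_symmetric:
  assumes U: "open U" "x \<in> U" and f: "\<And>y. y \<in> U \<Longrightarrow> f differentiable (at y)"
    and d: "pd i f differentiable (at x)" "pd j f differentiable (at x)"
  shows "pd i (pd j f) x = pd j (pd i f) x"
proof -
  have quot: "((\<lambda>h. (f (x + h *\<^sub>R axis i 1 + h *\<^sub>R axis j 1) - f (x + h *\<^sub>R axis i 1)
        - f (x + h *\<^sub>R axis j 1) + f x) / h\<^sup>2) \<longlongrightarrow> pd j (pd i f) x) (at_right 0)"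
    if d: "pd i f differentiable (at x)" for i j :: 4
  proof (rule tendstoI)
    fix e :: real assume e: "e > 0"
    let ?L = "frechet_derivative (pd i f) (at x)"
    have L: "(pd i f has_derivative ?L) (at x)" using d frechet_derivative_works by blast
    then interpret L: bounded_linear ?L by (rule has_derivative_bounded_linear)
    obtain \<epsilon> where \<epsilon>: "\<epsilon> > 0" "ball x \<epsilon> \<subseteq> U" using U openE by blast
    obtain \<delta> where \<delta>: "\<delta> > 0"
      "\<And>y. norm (y - x) < \<delta> \<Longrightarrow> norm (pd i f y - pd i f x - ?L (y - x)) \<le> e/4 * norm (y - x)"
      using L e unfolding has_derivative_at_alt by (metis zero_less_divide_iff zero_less_numeral)
    have "\<forall>\<^sub>F h in at_right 0. h \<in> {0<..< min \<epsilon> \<delta> / 2}"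
      using \<epsilon> \<delta> by (intro eventually_at_right_real) auto
    then show "\<forall>\<^sub>F h in at_right 0. dist ((f (x + h *\<^sub>R axis i 1 + h *\<^sub>R axis j 1) - f (x + h *\<^sub>R axis i 1)
        - f (x + h *\<^sub>R axis j 1) + f x) / h\<^sup>2) (pd j (pd i f) x) < e"
    proof eventually_elim
      case (elim h)
      define g where "g s = f (x + s *\<^sub>R axis i 1 + h *\<^sub>R axis j 1) - f (x + s *\<^sub>R axis i 1)" for s
      have h: "0 < h" "2 * h < \<epsilon>" "2 * h < \<delta>" using elim by auto
      have nrm: "norm (s *\<^sub>R axis i 1 + t *\<^sub>R axis j (1::real) :: real^4) \<le> \<bar>s\<bar> + \<bar>t\<bar>" for s t
        by (rule order_trans[OF norm_triangle_ineq]) simp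
      have dist_shift: "dist x (x + w) = norm w" for w by (simp add: dist_norm)
      have nrm2: "norm (s *\<^sub>R axis i 1 + t *\<^sub>R axis j (1::real) :: real^4) \<le> 2 * h"
        if "0 \<le> s" "s \<le> h" "0 \<le> t" "t \<le> h" for s t
        using nrm[of s t] that by simp
      have inU: "x + s *\<^sub>R axis i 1 + t *\<^sub>R axis j 1 \<in> U"
        if "0 \<le> s" "s \<le> h" "0 \<le> t" "t \<le> h" for s t
      proof -
        have "dist x (x + s *\<^sub>R axis i 1 + t *\<^sub>R axis j 1) < \<epsilon>"
          using nrm2[OF that] h(2) dist_shift[of "s *\<^sub>R axis i 1 + t *\<^sub>R axis j 1"]
          by (simp only: add.assoc)
        then show ?thesis using \<epsilon> by auto
      qed
      have line: "((\<lambda>s. f (x + s *\<^sub>R axis i 1 + t *\<^sub>R axis j 1)) has_real_derivative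
          pd i f (x + s *\<^sub>R axis i 1 + t *\<^sub>R axis j 1)) (at s)"
        if "0 \<le> s" "s \<le> h" "0 \<le> t" "t \<le> h" for s t
      proof -
        let ?y = "x + s *\<^sub>R axis i 1 + t *\<^sub>R axis j 1"
        have fd: "(f has_derivative frechet_derivative f (at ?y)) (at ?y)"
          using f[OF inU[OF that]] frechet_derivative_works by blast
        have "((\<lambda>s. x + s *\<^sub>R axis i 1 + t *\<^sub>R axis j 1) has_derivative (\<lambda>k. k *\<^sub>R axis i 1)) (at s)"
          by (auto intro!: derivative_eq_intros)
        from diff_chain_at[OF this fd]
        have "((\<lambda>s. f (x + s *\<^sub>R axis i 1 + t *\<^sub>R axis j 1)) has_derivative
            (\<lambda>k. frechet_derivative f (at ?y) (k *\<^sub>R axis i 1))) (at s)"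
          by (simp add: o_def)
        moreover have "frechet_derivative f (at ?y) (k *\<^sub>R axis i 1) = pd i f ?y * k" for k
          using linear_frechet_derivative[OF f[OF inU[OF that]]]
          by (simp add: linear_cmul pd_def mult.commute)
        ultimately show ?thesis by (simp add: has_field_derivative_def)
      qed
      \<comment> \<open>The second difference is \<open>g h - g 0\<close>; the mean value theorem turns it into a first difference of \<open>pd i f\<close>.\<close>
      have "\<exists>z::real. z > 0 \<and> z < h \<and> g h - g 0 = (h - 0) *
          (pd i f (x + z *\<^sub>R axis i 1 + h *\<^sub>R axis j 1) - pd i f (x + z *\<^sub>R axis i 1))"
      proof (rule MVT2)
        fix s assume "0 \<le> s" "s \<le> h"
        then show "(g has_real_derivative pd i f (x + s *\<^sub>R axis i 1 + h *\<^sub>R axis j 1) - pd i f (x + s *\<^sub>R axis i 1)) (at s)"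
          unfolding g_def using line[of s h] line[of s 0] h by (intro DERIV_diff) auto
      qed (use h in auto)
      then obtain z where z: "0 < z" "z < h" "g h - g 0 = h *
          (pd i f (x + z *\<^sub>R axis i 1 + h *\<^sub>R axis j 1) - pd i f (x + z *\<^sub>R axis i 1))" by auto
      have approx: "\<bar>pd i f (x + w) - pd i f x - ?L w\<bar> \<le> e/4 * d" if "norm w \<le> d" "d < \<delta>" for w d
      proof -
        have "norm (pd i f (x + w) - pd i f x - ?L w) \<le> e/4 * norm w"
          using \<delta>(2)[of "x + w"] that by simp
        also have "\<dots> \<le> e/4 * d" using that e by (intro mult_left_mono) auto
        finally show ?thesis by simp
      qed
      have p1: "\<bar>pd i f (x + z *\<^sub>R axis i 1 + h *\<^sub>R axis j 1) - pd i f x - ?L (z *\<^sub>R axis i 1 + h *\<^sub>R axis j 1)\<bar>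
          \<le> e/4 * (2 * h)"
        unfolding add.assoc using nrm2[of z h] z h by (intro approx) auto
      have p2: "\<bar>pd i f (x + z *\<^sub>R axis i 1) - pd i f x - ?L (z *\<^sub>R axis i 1)\<bar> \<le> e/4 * h"
        using z h by (intro approx) auto
      have Lj: "?L (z *\<^sub>R axis i 1 + h *\<^sub>R axis j 1) = ?L (z *\<^sub>R axis i 1) + h * pd j (pd i f) x"
        by (simp add: L.add L.scaleR pd_def)
      have "\<bar>(pd i f (x + z *\<^sub>R axis i 1 + h *\<^sub>R axis j 1) - pd i f (x + z *\<^sub>R axis i 1)) - h * pd j (pd i f) x\<bar>
          \<le> 3/4 * e * h"
        using p1 p2 unfolding Lj by linarith
      also have "\<dots> < e * h" using e h by simp
      finally have main: "\<bar>(pd i f (x + z *\<^sub>R axis i 1 + h *\<^sub>R axis j 1) - pd i f (x + z *\<^sub>R axis i 1)) - h * pd j (pd i f) x\<bar> < e * h" .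
      have eq: "(f (x + h *\<^sub>R axis i 1 + h *\<^sub>R axis j 1) - f (x + h *\<^sub>R axis i 1)
        - f (x + h *\<^sub>R axis j 1) + f x) / h\<^sup>2 - pd j (pd i f) x =
        ((pd i f (x + z *\<^sub>R axis i 1 + h *\<^sub>R axis j 1) - pd i f (x + z *\<^sub>R axis i 1)) - h * pd j (pd i f) x) / h"
      proof -
        have "f (x + h *\<^sub>R axis i 1 + h *\<^sub>R axis j 1) - f (x + h *\<^sub>R axis i 1)
            - f (x + h *\<^sub>R axis j 1) + f x
          = h * (pd i f (x + z *\<^sub>R axis i 1 + h *\<^sub>R axis j 1) - pd i f (x + z *\<^sub>R axis i 1))"
          using z(3) unfolding g_def by simp
        moreover have "h * p / h\<^sup>2 - q = (p - h * q) / h" for p q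
          using h by (simp add: field_simps power2_eq_square)
        ultimately show ?thesis by (simp only:)
      qed
      show ?case unfolding dist_real_def eq abs_divide using main h by (simp add: field_simps)
    qed
  qed
  have "((\<lambda>h. (f (x + h *\<^sub>R axis i 1 + h *\<^sub>R axis j 1) - f (x + h *\<^sub>R axis i 1)
        - f (x + h *\<^sub>R axis j 1) + f x) / h\<^sup>2) \<longlongrightarrow> pd i (pd j f) x) (at_right 0)"
    using quot[OF d(2), of i] by (simp add: algebra_simps)
  then show ?thesis
    using tendsto_unique[OF _ _ quot[OF d(1), of j]] by simp
qed

section \<open>Divergence of the energy-momentum tensor of a one-form\<close>

abbreviation raise :: "real^4^4 \<Rightarrow> real^4 \<Rightarrow> real^4" where
  "raise g V \<equiv> matrix_inv g *v V"

text \<open>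
  The inner product of covectors, as a function of the metric matrix at the point only. This is the form
  in which it can occur in a tensor that depends on the metric components.
\<close>

definition ip :: "real^4^4 \<Rightarrow> real^4 \<Rightarrow> real^4 \<Rightarrow> real" where
  "ip g V W = V \<bullet> raise g W"

definition stress :: "real^4^4 \<Rightarrow> real^4 \<Rightarrow> real^4^4" where
  "stress g V = (\<chi> i j. V $ i * V $ j - g $ i $ j * ip g V V / 2)"

definition wedge :: "real^4 \<Rightarrow> real^4 \<Rightarrow> real^4^4" where
  "wedge V W = (\<chi> i j. V $ i * W $ j - V $ j * W $ i)"

definition ext_deriv :: "(real^4 \<Rightarrow> real^4) \<Rightarrow> real^4 \<Rightarrow> real^4^4" where
  "ext_deriv V x = (\<chi> i j. pd i (\<lambda>y. V y $ j) x - pd j (\<lambda>y. V y $ i) x)"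

definition codiv :: "(real^4 \<Rightarrow> real^4^4) \<Rightarrow> (real^4 \<Rightarrow> real^4) \<Rightarrow> real^4 \<Rightarrow> real" where
  "codiv G V x = (\<Sum>i\<in>UNIV. \<Sum>j\<in>UNIV. matrix_inv (G x) $ i $ j * cov_deriv1 G V x i j)"

lemma wave_op_eq_codiv: "wave_op G f = codiv G (differential f)"
  by (simp add: wave_op_def codiv_def fun_eq_iff)

lemma ip_expand: "ip g V W = (\<Sum>i\<in>UNIV. \<Sum>j\<in>UNIV. matrix_inv g $ i $ j * V $ i * W $ j)"
  by (simp add: ip_def inner_vec_def matrix_vector_mult_def sum_distrib_left mult_ac)

lemma covector_inner_eq_ip: "covector_inner G x = ip (G x)"
  by (simp add: covector_inner_def ip_expand fun_eq_iff)

text \<open>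
  A metric differentiable at a point. The inverse is required near the point, and not only at it, because
  the raised components of a one-form are differentiated.
\<close>

locale metric_at =
  fixes G :: "real^4 \<Rightarrow> real^4^4" and x :: "real^4"
  assumes g_sym: "G y $ i $ j = G y $ j $ i"
    and inverse: "\<forall>\<^sub>F y in nhds x. matrix_inv (G y) ** G y = mat 1 \<and> G y ** matrix_inv (G y) = mat 1"
    and g_differentiable: "(\<lambda>y. G y $ i $ j) differentiable (at x)"
    and g_inverse_differentiable: "(\<lambda>y. matrix_inv (G y) $ i $ j) differentiable (at x)"
begin

lemma g_inverse_left: "(\<Sum>k\<in>UNIV. matrix_inv (G x) $ i $ k * G x $ k $ j) = (if i = j then 1 else 0)"
  and g_inverse_right: "(\<Sum>k\<in>UNIV. G x $ i $ k * matrix_inv (G x) $ k $ j) = (if i = j then 1 else 0)"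
  using eventually_nhds_x_imp_x[OF inverse]
  by (auto simp: matrix_matrix_mult_def mat_def vec_eq_iff)

lemma g_inverse_sym: "matrix_inv (G x) $ i $ j = matrix_inv (G x) $ j $ i"
proof -
  let ?H = "matrix_inv (G x)"
  have T: "transpose (G x) = G x" by (simp add: transpose_def vec_eq_iff g_sym)
  have HG: "?H ** G x = mat 1" and GH: "G x ** ?H = mat 1"
    using eventually_nhds_x_imp_x[OF inverse] by auto
  have "transpose ?H = (transpose ?H ** G x) ** ?H"
    by (simp add: matrix_mul_assoc[symmetric] GH)
  also have "transpose ?H ** G x = transpose (G x ** ?H)"
    by (simp add: matrix_transpose_mul T)
  finally have "transpose ?H = ?H" by (simp add: GH transpose_mat)
  then show ?thesis by (simp add: transpose_def vec_eq_iff)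
qed

lemma ip_commute: "ip (G x) V W = ip (G x) W V"
proof -
  have "transpose (matrix_inv (G x)) = matrix_inv (G x)"
    by (simp add: transpose_def vec_eq_iff g_inverse_sym)
  then show ?thesis
    unfolding ip_def by (metis dot_lmul_matrix inner_commute transpose_matrix_vector)
qed

lemma lower_raise: "(\<Sum>j\<in>UNIV. G x $ i $ j * raise (G x) V $ j) = V $ i"
proof -
  have "G x *v raise (G x) V = V"
    using eventually_nhds_x_imp_x[OF inverse] by (simp add: matrix_vector_mul_assoc)
  then show ?thesis by (simp add: vec_eq_iff matrix_vector_mult_def)
qed

lemma christoffel_sym: "christoffel G x k i j = christoffel G x k j i"
proof -
  have *: "(\<lambda>y. G y $ i $ j) = (\<lambda>y. G y $ j $ i)" by (rule ext, rule g_sym)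
  show ?thesis unfolding christoffel_def * by (simp only: add.commute)
qed

text \<open>
  Metric compatibility of the Christoffel symbols: the covariant derivative of the metric vanishes.
\<close>

lemma pd_metric:
  "pd k (\<lambda>y. G y $ i $ j) x =
     (\<Sum>l\<in>UNIV. christoffel G x l k i * G x $ l $ j) + (\<Sum>l\<in>UNIV. christoffel G x l k j * G x $ i $ l)"
proof -
  have low: "(\<Sum>l\<in>UNIV. christoffel G x l a b * G x $ l $ c) =
      (pd a (\<lambda>y. G y $ b $ c) x + pd b (\<lambda>y. G y $ a $ c) x - pd c (\<lambda>y. G y $ a $ b) x) / 2" for a b c
  proof -
    let ?F = "\<lambda>m. pd a (\<lambda>y. G y $ b $ m) x + pd b (\<lambda>y. G y $ a $ m) x - pd m (\<lambda>y. G y $ a $ b) x"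
    have "(\<Sum>l\<in>UNIV. christoffel G x l a b * G x $ l $ c) =
        (\<Sum>l\<in>UNIV. \<Sum>m\<in>UNIV. (matrix_inv (G x) $ m $ l * G x $ l $ c) * (?F m / 2))"
      unfolding christoffel_def sum_divide_distrib sum_distrib_right
      by (intro sum.cong refl) (simp add: g_inverse_sym)
    also have "\<dots> = (\<Sum>m\<in>UNIV. (\<Sum>l\<in>UNIV. matrix_inv (G x) $ m $ l * G x $ l $ c) * (?F m / 2))"
      by (subst sum.swap) (simp only: sum_distrib_right)
    also have "\<dots> = (\<Sum>m\<in>UNIV. if m = c then ?F m / 2 else 0)"
      by (intro sum.cong refl) (simp add: g_inverse_left)
    also have "\<dots> = ?F c / 2" by simp
    finally show ?thesis .
  qed
  have *: "(\<lambda>y. G y $ j $ i) = (\<lambda>y. G y $ i $ j)" and **: "\<And>l. G x $ i $ l = G x $ l $ i"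
    by (rule ext, rule g_sym) (rule g_sym)
  show ?thesis
    unfolding ** low * by (simp add: add_divide_distrib diff_divide_distrib)
qed

end

lemma cov_deriv1_scale:
  assumes "f differentiable (at x)" "V differentiable (at x)"
  shows "cov_deriv1 G (\<lambda>y. f y *\<^sub>R V y) x i j = pd i f x * V x $ j + f x * cov_deriv1 G V x i j"
proof -
  have "pd i (\<lambda>y. f y * V y $ j) x = pd i f x * V x $ j + f x * pd i (\<lambda>y. V y $ j) x"
    using assms by (intro pd_mult differentiable_vec_nth)
  then show ?thesis
    by (simp add: cov_deriv1_def algebra_simps sum_distrib_left)
qed

lemma cov_deriv1_add:
  assumes "V differentiable (at x)" "W differentiable (at x)"
  shows "cov_deriv1 G (\<lambda>y. V y + W y) x i j = cov_deriv1 G V x i j + cov_deriv1 G W x i j"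
  using assms by (simp add: cov_deriv1_def pd_add differentiable_vec_nth sum.distrib algebra_simps)

lemma cov_deriv1_diff:
  assumes "V differentiable (at x)" "W differentiable (at x)"
  shows "cov_deriv1 G (\<lambda>y. V y - W y) x i j = cov_deriv1 G V x i j - cov_deriv1 G W x i j"
  using assms by (simp add: cov_deriv1_def pd_diff differentiable_vec_nth sum_subtractf algebra_simps)

lemma codiv_add:
  assumes "V differentiable (at x)" "W differentiable (at x)"
  shows "codiv G (\<lambda>y. V y + W y) x = codiv G V x + codiv G W x"
  using assms by (simp add: codiv_def cov_deriv1_add sum.distrib algebra_simps)

lemma codiv_diff:
  assumes "V differentiable (at x)" "W differentiable (at x)"
  shows "codiv G (\<lambda>y. V y - W y) x = codiv G V x - codiv G W x"
  using assms by (simp add: codiv_def cov_deriv1_diff sum_subtractf algebra_simps)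

lemma codiv_scale:
  assumes "f differentiable (at x)" "V differentiable (at x)"
  shows "codiv G (\<lambda>y. f y *\<^sub>R V y) x = ip (G x) (differential f x) (V x) + f x * codiv G V x"
  using assms
  by (simp add: codiv_def cov_deriv1_scale sum.distrib algebra_simps ip_expand differential_def sum_distrib_left)

lemma ext_deriv_add:
  assumes "V differentiable (at x)" "W differentiable (at x)"
  shows "ext_deriv (\<lambda>y. V y + W y) x = ext_deriv V x + ext_deriv W x"
  using assms by (simp add: ext_deriv_def vec_eq_iff pd_add differentiable_vec_nth)

lemma ext_deriv_diff:
  assumes "V differentiable (at x)" "W differentiable (at x)"
  shows "ext_deriv (\<lambda>y. V y - W y) x = ext_deriv V x - ext_deriv W x"
  using assms by (simp add: ext_deriv_def vec_eq_iff pd_diff differentiable_vec_nth)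

lemma ext_deriv_scale:
  assumes "f differentiable (at x)" "V differentiable (at x)"
  shows "ext_deriv (\<lambda>y. f y *\<^sub>R V y) x = wedge (differential f x) (V x) + f x *\<^sub>R ext_deriv V x"
  using assms
  by (simp add: ext_deriv_def vec_eq_iff wedge_def differential_def pd_mult differentiable_vec_nth algebra_simps)

lemma ext_deriv_differential:
  assumes "open U" "x \<in> U" "\<And>y. y \<in> U \<Longrightarrow> f differentiable (at y)"
    and "\<And>i. pd i f differentiable (at x)"
  shows "ext_deriv (differential f) x = 0"
  using pd_symmetric[OF assms(1,2,3) assms(4) assms(4)]
  by (simp add: ext_deriv_def vec_eq_iff differential_def)

lemma divergence_add:
  assumes "P differentiable (at x)" "Q differentiable (at x)"
  shows "divergence G (\<lambda>y. P y + Q y) x = divergence G P x + divergence G Q x"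
proof -
  have "cov_deriv2 G (\<lambda>y. P y + Q y) x k i j = cov_deriv2 G P x k i j + cov_deriv2 G Q x k i j" for k i j
    using assms by (simp add: cov_deriv2_def pd_add differentiable_vec_nth sum.distrib algebra_simps)
  then show ?thesis
    by (simp add: divergence_def vec_eq_iff sum.distrib algebra_simps)
qed

context metric_at
begin

lemma differentiable_raise:
  assumes "V differentiable (at x)"
  shows "(\<lambda>y. raise (G y) (V y) $ i) differentiable (at x)"
  unfolding matrix_vector_mult_def using assms
  by (auto intro!: differentiable_sum differentiable_mult g_inverse_differentiable differentiable_vec_nth)

lemma differentiable_ip:
  assumes "V differentiable (at x)" "W differentiable (at x)"
  shows "(\<lambda>y. ip (G y) (V y) (W y)) differentiable (at x)"
  unfolding ip_def inner_vec_def inner_real_def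
  using differentiable_vec_nth[OF assms(1)] differentiable_raise[OF assms(2)]
  by (auto intro!: differentiable_sum differentiable_mult)

lemma differentiable_stress:
  assumes "V differentiable (at x)"
  shows "(\<lambda>y. stress (G y) (V y)) differentiable (at x)"
proof (intro differentiable_vecI)
  show "(\<lambda>y. stress (G y) (V y) $ i $ j) differentiable (at x)" for i j
    unfolding stress_def vec_lambda_beta
    by (intro differentiable_diff differentiable_mult differentiable_divide differentiable_const
        differentiable_ip g_differentiable differentiable_vec_nth assms) simp
qed

text \<open>
  Differentiating \<open>|V|\<^sup>2\<close> as \<open>V\<close> paired with the raised vector \<open>R\<close>, and the identity \<open>V = g R\<close>, gives two
  equations for the derivative of \<open>R\<close>. Eliminating it avoids the derivative of the inverse metric;
  what remains of the derivative of \<open>g\<close> is expressed by Christoffel symbols.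
\<close>

lemma pd_ip_self:
  assumes V: "V differentiable (at x)"
  shows "pd k (\<lambda>y. ip (G y) (V y) (V y)) x = 2 * (\<Sum>n\<in>UNIV. raise (G x) (V x) $ n * cov_deriv1 G V x k n)"
proof -
  define R where "R y = raise (G y) (V y)" for y
  have dR: "(\<lambda>y. R y $ i) differentiable (at x)" for i
    unfolding R_def by (rule differentiable_raise[OF V])
  have dV: "(\<lambda>y. V y $ i) differentiable (at x)" for i
    by (rule differentiable_vec_nth[OF V])
  have lower: "(\<Sum>j\<in>UNIV. G x $ i $ j * R x $ j) = V x $ i" for i
    unfolding R_def by (rule lower_raise)
  have 1: "pd k (\<lambda>y. ip (G y) (V y) (V y)) x =
      (\<Sum>i\<in>UNIV. R x $ i * pd k (\<lambda>y. V y $ i) x) + (\<Sum>i\<in>UNIV. V x $ i * pd k (\<lambda>y. R y $ i) x)"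
    unfolding ip_def R_def[symmetric] inner_vec_def inner_real_def
    by (subst pd_sum) (auto simp: pd_mult dV dR sum.distrib algebra_simps intro!: differentiable_mult dV dR)
  have pdV: "pd k (\<lambda>y. V y $ i) x =
      (\<Sum>j\<in>UNIV. pd k (\<lambda>y. G y $ i $ j) x * R x $ j + G x $ i $ j * pd k (\<lambda>y. R y $ j) x)" for i
  proof -
    have "\<forall>\<^sub>F y in nhds x. V y $ i = (\<Sum>j\<in>UNIV. G y $ i $ j * R y $ j)"
      using inverse
    proof eventually_elim
      case (elim y)
      then have "G y *v R y = V y" by (simp add: R_def matrix_vector_mul_assoc)
      then show ?case by (metis (no_types, lifting) matrix_vector_mult_def vec_lambda_beta sum.cong)
    qed
    from pd_cong[OF this] show ?thesis
      by (simp add: pd_sum pd_mult differentiable_mult g_differentiable dR)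
  qed
  define S where "S = (\<Sum>i\<in>UNIV. \<Sum>j\<in>UNIV. R x $ i * R x $ j * pd k (\<lambda>y. G y $ i $ j) x)"
  have 2: "(\<Sum>i\<in>UNIV. R x $ i * pd k (\<lambda>y. V y $ i) x) = S + (\<Sum>i\<in>UNIV. V x $ i * pd k (\<lambda>y. R y $ i) x)"
  proof -
    have "(\<Sum>i\<in>UNIV. R x $ i * pd k (\<lambda>y. V y $ i) x) =
        S + (\<Sum>i\<in>UNIV. \<Sum>j\<in>UNIV. R x $ i * G x $ i $ j * pd k (\<lambda>y. R y $ j) x)"
      by (simp add: pdV S_def sum_distrib_left sum.distrib[symmetric] algebra_simps)
    also have "(\<Sum>i\<in>UNIV. \<Sum>j\<in>UNIV. R x $ i * G x $ i $ j * pd k (\<lambda>y. R y $ j) x) =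
        (\<Sum>j\<in>UNIV. (\<Sum>i\<in>UNIV. G x $ j $ i * R x $ i) * pd k (\<lambda>y. R y $ j) x)"
      unfolding sum_distrib_right
      by (subst sum.swap, intro sum.cong refl, subst g_sym) (simp only: mult.commute)
    finally show ?thesis by (simp add: lower)
  qed
  have 3: "S = 2 * (\<Sum>i\<in>UNIV. R x $ i * (\<Sum>l\<in>UNIV. christoffel G x l k i * V x $ l))"
  proof -
    have a: "(\<Sum>i\<in>UNIV. \<Sum>j\<in>UNIV. R x $ i * R x $ j * (\<Sum>l\<in>UNIV. christoffel G x l k i * G x $ l $ j)) =
        (\<Sum>i\<in>UNIV. R x $ i * (\<Sum>l\<in>UNIV. christoffel G x l k i * (\<Sum>j\<in>UNIV. G x $ l $ j * R x $ j)))"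
      unfolding sum_distrib_left
      by (rule sum.cong[OF refl], rule trans[OF sum.swap], intro sum.cong refl) (simp only: mult_ac)
    have b: "(\<Sum>i\<in>UNIV. \<Sum>j\<in>UNIV. R x $ i * R x $ j * (\<Sum>l\<in>UNIV. christoffel G x l k j * G x $ i $ l)) =
        (\<Sum>i\<in>UNIV. \<Sum>j\<in>UNIV. R x $ i * R x $ j * (\<Sum>l\<in>UNIV. christoffel G x l k i * G x $ l $ j))"
    proof (rule trans[OF sum.swap], intro sum.cong refl)
      fix i j
      have "(\<Sum>l\<in>UNIV. christoffel G x l k i * G x $ j $ l) = (\<Sum>l\<in>UNIV. christoffel G x l k i * G x $ l $ j)"
        by (intro sum.cong refl, subst g_sym) (rule refl)
      then show "R x $ j * R x $ i * (\<Sum>l\<in>UNIV. christoffel G x l k i * G x $ j $ l) =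
          R x $ i * R x $ j * (\<Sum>l\<in>UNIV. christoffel G x l k i * G x $ l $ j)"
        by (simp only: mult.commute[of "R x $ j"])
    qed
    show ?thesis
      unfolding S_def pd_metric distrib_left sum.distrib b unfolding a lower by simp
  qed
  have "(\<Sum>n\<in>UNIV. R x $ n * cov_deriv1 G V x k n) =
      (\<Sum>i\<in>UNIV. R x $ i * pd k (\<lambda>y. V y $ i) x)
        - (\<Sum>i\<in>UNIV. R x $ i * (\<Sum>l\<in>UNIV. christoffel G x l k i * V x $ l))"
    by (simp add: cov_deriv1_def right_diff_distrib sum_subtractf)
  then show ?thesis using 1 2 3 unfolding R_def by simp
qed

text \<open>
  The covariant derivatives of \<open>V\<close> enter through \<open>V\<^sup>k (D\<^sub>k V\<^sub>m - D\<^sub>m V\<^sub>k)\<close>, which is an exterior derivative by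
  the symmetry of the Christoffel symbols.
\<close>

lemma divergence_stress:
  assumes V: "V differentiable (at x)"
  shows "divergence G (\<lambda>y. stress (G y) (V y)) x =
    codiv G V x *\<^sub>R V x + raise (G x) (V x) v* ext_deriv V x"
proof (subst vec_eq_iff, rule allI)
  fix m
  let ?h = "matrix_inv (G x)" and ?N = "cov_deriv1 G V x" and ?f = "\<lambda>y. ip (G y) (V y) (V y)"
  let ?R = "raise (G x) (V x)"
  have dV: "(\<lambda>y. V y $ i) differentiable (at x)" for i
    by (rule differentiable_vec_nth[OF V])
  have stress_deriv: "cov_deriv2 G (\<lambda>y. stress (G y) (V y)) x k i j =
      ?N k i * V x $ j + V x $ i * ?N k j - pd k ?f x / 2 * G x $ i $ j" for k i j
  proof -
    have "pd k (\<lambda>y. stress (G y) (V y) $ i $ j) x =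
        pd k (\<lambda>y. V y $ i * V y $ j) x - pd k (\<lambda>y. G y $ i $ j * (?f y * (1/2))) x"
      unfolding stress_def vec_lambda_beta times_divide_eq_right[symmetric]
      by (subst pd_diff) (auto intro!: differentiable_mult dV g_differentiable differentiable_ip V differentiable_divide)
    also have "\<dots> = pd k (\<lambda>y. V y $ i) x * V x $ j + V x $ i * pd k (\<lambda>y. V y $ j) x
        - (pd k (\<lambda>y. G y $ i $ j) x * ?f x / 2 + G x $ i $ j * pd k ?f x / 2)"
      unfolding pd_mult[OF dV dV] pd_mult[OF g_differentiable differentiable_mult[OF differentiable_ip[OF V V] differentiable_const]]
        pd_mult[OF differentiable_ip[OF V V] differentiable_const] by simp
    finally have pdS: "pd k (\<lambda>y. stress (G y) (V y) $ i $ j) x = \<dots>" .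
    show ?thesis
      unfolding cov_deriv2_def pdS unfolding pd_metric cov_deriv1_def stress_def vec_lambda_beta
      by (simp add: algebra_simps sum_subtractf sum_distrib_left sum_divide_distrib)
  qed
  have R: "?R $ k = (\<Sum>n\<in>UNIV. ?h $ k $ n * V x $ n)" for k by (simp add: matrix_vector_mult_def)
  have A: "(\<Sum>k\<in>UNIV. \<Sum>n\<in>UNIV. ?h $ k $ n * (?N k m * V x $ n)) = (\<Sum>k\<in>UNIV. ?R $ k * ?N k m)"
    unfolding R sum_distrib_right by (simp only: mult_ac)
  have B: "(\<Sum>k\<in>UNIV. \<Sum>n\<in>UNIV. ?h $ k $ n * (V x $ m * ?N k n)) = codiv G V x * V x $ m"
    unfolding codiv_def sum_distrib_right by (simp only: mult_ac)
  have C: "(\<Sum>k\<in>UNIV. \<Sum>n\<in>UNIV. ?h $ k $ n * (pd k ?f x / 2 * G x $ m $ n)) = pd m ?f x / 2"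
  proof -
    have "(\<Sum>k\<in>UNIV. \<Sum>n\<in>UNIV. ?h $ k $ n * (pd k ?f x / 2 * G x $ m $ n)) =
        (\<Sum>k\<in>UNIV. (\<Sum>n\<in>UNIV. G x $ m $ n * ?h $ n $ k) * (pd k ?f x / 2))"
      unfolding sum_distrib_right
      by (intro sum.cong refl) (simp add: g_inverse_sym)
    also have "\<dots> = (\<Sum>k\<in>UNIV. if k = m then pd k ?f x / 2 else 0)"
      by (intro sum.cong refl) (simp add: g_inverse_right)
    finally show ?thesis by simp
  qed
  have "divergence G (\<lambda>y. stress (G y) (V y)) x $ m =
      (\<Sum>k\<in>UNIV. ?R $ k * ?N k m) + codiv G V x * V x $ m - pd m ?f x / 2"
    unfolding divergence_def vec_lambda_beta stress_deriv right_diff_distrib distrib_left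
      sum.distrib sum_subtractf A B C ..
  also have "pd m ?f x / 2 = (\<Sum>k\<in>UNIV. ?R $ k * ?N m k)"
    using pd_ip_self[OF V, of m] by simp
  also have "(\<Sum>k\<in>UNIV. ?R $ k * ?N k m) + codiv G V x * V x $ m - (\<Sum>k\<in>UNIV. ?R $ k * ?N m k)
     = codiv G V x * V x $ m + (\<Sum>k\<in>UNIV. ?R $ k * (?N k m - ?N m k))"
    by (simp add: right_diff_distrib sum_subtractf)
  also have "\<dots> = (codiv G V x *\<^sub>R V x + ?R v* ext_deriv V x) $ m"
    by (simp add: cov_deriv1_def christoffel_sym[of _ m] ext_deriv_def vector_matrix_mult_def mult.commute)
  finally show "divergence G (\<lambda>y. stress (G y) (V y)) x $ m = \<dots>" .
qed

end

section \<open>The energy tensor of the linearized equations\<close>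

lemma ip_linear:
  "ip g (V + W) U = ip g V U + ip g W U" "ip g (V - W) U = ip g V U - ip g W U"
  "ip g (c *\<^sub>R V) U = c * ip g V U"
  "ip g U (V + W) = ip g U V + ip g U W" "ip g U (V - W) = ip g U V - ip g U W"
  "ip g U (c *\<^sub>R V) = c * ip g U V"
  by (simp_all add: ip_def inner_add_left inner_add_right inner_diff_left inner_diff_right
      matrix_vector_right_distrib matrix_vector_mult_diff_distrib matrix_vector_mult_scaleR)

lemma ip_minus: "ip g (- V) U = - ip g V U" "ip g U (- V) = - ip g U V"
  using ip_linear(3)[of g "-1" V U] ip_linear(6)[of g U "-1" V] by simp_all

lemma raise_wedge: "raise g V v* wedge X Y = ip g X V *\<^sub>R Y - ip g Y V *\<^sub>R X"
  by (simp add: vec_eq_iff vector_matrix_mult_def wedge_def ip_def inner_vec_def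
      sum_subtractf left_diff_distrib right_diff_distrib sum_distrib_left mult_ac)

text \<open>
  The divergence of \<open>stress g V\<close> for a one-form with divergence \<open>d\<close> and exterior derivative \<open>F\<close>.
\<close>

definition source :: "real^4^4 \<Rightarrow> real^4 \<Rightarrow> real \<Rightarrow> real^4^4 \<Rightarrow> real^4" where
  "source g V d F = d *\<^sub>R V + raise g V v* F"

text \<open>
  The one-forms \<open>dA / A\<close> and \<open>dB / A\<close> of the background jet \<open>p = ((A, B), (dA, dB))\<close>.
\<close>

definition log_form :: "jet \<Rightarrow> real^4" where
  "log_form p = (1 / fst (fst p)) *\<^sub>R fst (snd p)"

definition twist_form :: "jet \<Rightarrow> real^4" where
  "twist_form p = (1 / fst (fst p)) *\<^sub>R snd (snd p)"

text \<open>
  The three one-forms of the quadratic form whose Euler--Lagrange equations are the linearized system,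
  with \<open>K\<close> the Hardy correction. In these definitions \<open>v = ((\<phi>, \<psi>), (d\<phi>, d\<psi>))\<close>.
\<close>

definition E_form :: "real^4 \<Rightarrow> jet \<Rightarrow> jet \<Rightarrow> real^4" where
  "E_form K p v = fst (snd v) + snd (fst v) *\<^sub>R twist_form p - fst (fst v) *\<^sub>R K"

definition F_form :: "real^4 \<Rightarrow> jet \<Rightarrow> jet \<Rightarrow> real^4" where
  "F_form K p v = snd (snd v) - fst (fst v) *\<^sub>R twist_form p - snd (fst v) *\<^sub>R K"

definition N_form :: "jet \<Rightarrow> jet \<Rightarrow> real^4" where
  "N_form p v = fst (fst v) *\<^sub>R twist_form p - snd (fst v) *\<^sub>R log_form p"

text \<open>
  The divergences of the three forms for a solution. The linearized equations eliminate the second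
  derivatives of \<open>\<phi>\<close> and \<open>\<psi>\<close>; the wave map equations for \<open>(A, B)\<close> say that \<open>dB / A\<close> has divergence
  \<open>\<langle>dA, dB\<rangle> / A\<^sup>2\<close> and \<open>dA / A\<close> has divergence \<open>- |dB|\<^sup>2 / A\<^sup>2\<close>. The number \<open>k\<close> is the divergence of \<open>K\<close>.
\<close>

definition E_div :: "real^4^4 \<Rightarrow> real^4 \<Rightarrow> real \<Rightarrow> jet \<Rightarrow> jet \<Rightarrow> real" where
  "E_div g K k p v =
     - ip g (twist_form p) (snd (snd v)) + 2 * ip g (twist_form p) (twist_form p) * fst (fst v)
     - ip g (twist_form p) (log_form p) * snd (fst v) - ip g K (fst (snd v)) - k * fst (fst v)"

definition F_div :: "real^4^4 \<Rightarrow> real^4 \<Rightarrow> real \<Rightarrow> jet \<Rightarrow> jet \<Rightarrow> real" where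
  "F_div g K k p v =
     ip g (twist_form p) (fst (snd v))
     + (ip g (log_form p) (log_form p) + ip g (twist_form p) (twist_form p)) * snd (fst v)
     - ip g (twist_form p) (log_form p) * fst (fst v) - ip g K (snd (snd v)) - k * snd (fst v)"

definition N_div :: "real^4^4 \<Rightarrow> jet \<Rightarrow> jet \<Rightarrow> real" where
  "N_div g p v =
     ip g (twist_form p) (fst (snd v)) + ip g (twist_form p) (log_form p) * fst (fst v)
     - ip g (log_form p) (snd (snd v)) + ip g (twist_form p) (twist_form p) * snd (fst v)"

text \<open>
  Their exterior derivatives, for closed \<open>K\<close>. They contain no second derivatives because
  \<open>d (dA / A) = 0\<close> and \<open>d (dB / A) = - (dA / A) \<and> (dB / A)\<close>.
\<close>

definition E_curl :: "real^4 \<Rightarrow> jet \<Rightarrow> jet \<Rightarrow> real^4^4" where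
  "E_curl K p v = wedge (snd (snd v)) (twist_form p)
     - snd (fst v) *\<^sub>R wedge (log_form p) (twist_form p) - wedge (fst (snd v)) K"

definition F_curl :: "real^4 \<Rightarrow> jet \<Rightarrow> jet \<Rightarrow> real^4^4" where
  "F_curl K p v = fst (fst v) *\<^sub>R wedge (log_form p) (twist_form p)
     - wedge (fst (snd v)) (twist_form p) - wedge (snd (snd v)) K"

definition N_curl :: "jet \<Rightarrow> jet \<Rightarrow> real^4^4" where
  "N_curl p v = wedge (fst (snd v)) (twist_form p)
     - fst (fst v) *\<^sub>R wedge (log_form p) (twist_form p) - wedge (snd (snd v)) (log_form p)"

definition energy_tensor :: "real^4^4 \<Rightarrow> real^4 \<Rightarrow> real^4 \<Rightarrow> jet \<Rightarrow> jet \<Rightarrow> real^4^4" where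
  "energy_tensor g K S p v =
     stress g (E_form K p v) + stress g (F_form K p v) + stress g (N_form p v)
     + stress g (fst (fst v) *\<^sub>R S) + stress g (snd (fst v) *\<^sub>R S)"

definition energy_source ::
  "real^4^4 \<Rightarrow> real^4 \<Rightarrow> real \<Rightarrow> real^4 \<Rightarrow> real \<Rightarrow> jet \<Rightarrow> jet \<Rightarrow> real^4" where
  "energy_source g K k S s p v =
     source g (E_form K p v) (E_div g K k p v) (E_curl K p v)
     + source g (F_form K p v) (F_div g K k p v) (F_curl K p v)
     + source g (N_form p v) (N_div g p v) (N_curl p v)
     + source g (fst (fst v) *\<^sub>R S) (ip g S (fst (snd v)) + s * fst (fst v)) (wedge (fst (snd v)) S)
     + source g (snd (fst v) *\<^sub>R S) (ip g S (snd (snd v)) + s * snd (fst v)) (wedge (snd (snd v)) S)"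

lemma quadratic_add: "quadratic f \<Longrightarrow> quadratic g \<Longrightarrow> quadratic (\<lambda>v. f v + g v)"
proof -
  assume "quadratic f" "quadratic g"
  then obtain b c where "bilinear b" "\<forall>v. f v = b v v" "bilinear c" "\<forall>v. g v = c v v"
    unfolding quadratic_def by auto
  then show ?thesis
    unfolding quadratic_def
    by (intro exI[of _ "\<lambda>u v. b u v + c u v"]) (auto simp: bilinear_def intro: linear_compose_add)
qed

lemma quadratic_stress:
  assumes "linear L"
  shows "quadratic (\<lambda>v. stress g (L v))"
  unfolding quadratic_def
proof (intro exI conjI allI)
  let ?b = "\<lambda>u v. \<chi> i j. L u $ i * L v $ j - g $ i $ j * ip g (L u) (L v) / 2"
  show "bilinear ?b"
    unfolding bilinear_def
    by (auto intro!: linearI simp: vec_eq_iff linear_add[OF assms] linear_cmul[OF assms] ip_linear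
        algebra_simps add_divide_distrib)
  show "stress g (L v) = ?b v v" for v by (simp add: stress_def)
qed

lemma quadratic_source:
  assumes "linear L" "linear d" "linear F"
  shows "quadratic (\<lambda>v. source g (L v) (d v) (F v))"
  unfolding quadratic_def
proof (intro exI conjI allI)
  let ?b = "\<lambda>u v. d u *\<^sub>R L v + raise g (L u) v* F v"
  have [simp]: "y v* (P + Q) = y v* P + y v* Q" "y v* (c *\<^sub>R P) = c *\<^sub>R (y v* P)"
    "(y + z) v* P = y v* P + z v* P" "(c *\<^sub>R y) v* P = c *\<^sub>R (y v* P)"
    for y z :: "real^4" and P Q :: "real^4^4" and c :: real
    by (simp_all add: vec_eq_iff vector_matrix_mult_def sum.distrib algebra_simps sum_distrib_left)
  show "bilinear ?b"
    unfolding bilinear_def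
    by (auto intro!: linearI simp: linear_add[OF assms(1)] linear_cmul[OF assms(1)]
        linear_add[OF assms(2)] linear_cmul[OF assms(2)] linear_add[OF assms(3)] linear_cmul[OF assms(3)]
        matrix_vector_right_distrib matrix_vector_mult_scaleR algebra_simps)
  show "source g (L v) (d v) (F v) = ?b v v" for v by (simp add: source_def)
qed

lemma linear_forms:
  "linear (E_form K p)" "linear (F_form K p)" "linear (N_form p)"
  "linear (\<lambda>v::jet. fst (fst v) *\<^sub>R S)" "linear (\<lambda>v::jet. snd (fst v) *\<^sub>R S)"
  "linear (E_div g K k p)" "linear (F_div g K k p)" "linear (N_div g p)"
  "linear (\<lambda>v::jet. ip g S (fst (snd v)) + s * fst (fst v))"
  "linear (\<lambda>v::jet. ip g S (snd (snd v)) + s * snd (fst v))"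
  by (auto intro!: linearI simp: E_form_def F_form_def N_form_def E_div_def F_div_def N_div_def
      ip_linear algebra_simps)

lemma linear_curls:
  "linear (E_curl K p)" "linear (F_curl K p)" "linear (N_curl p)"
  "linear (\<lambda>v::jet. wedge (fst (snd v)) S)" "linear (\<lambda>v::jet. wedge (snd (snd v)) S)"
  by (auto intro!: linearI simp: E_curl_def F_curl_def N_curl_def wedge_def vec_eq_iff algebra_simps)

lemma quadratic_energy_tensor: "quadratic (energy_tensor g K S p)"
  unfolding energy_tensor_def by (intro quadratic_add quadratic_stress linear_forms)

lemma quadratic_energy_source: "quadratic (energy_source g K k S s p)"
  unfolding energy_source_def by (intro quadratic_add quadratic_source linear_forms linear_curls)

text \<open>
  The one-forms pair with \<open>X\<close> only through the derivatives \<open>X \<phi>\<close> and \<open>X \<psi>\<close>. In the coefficient of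
  each of these the terms with \<open>dA / A\<close> and \<open>dB / A\<close> cancel, and what is left is \<open>\<phi>\<close>, respectively \<open>\<psi>\<close>, times
  \<open>- (div K + |K|\<^sup>2 + |S|\<^sup>2)\<close>.
\<close>

lemma energy_source_orthogonal:
  fixes X :: "real^4"
  assumes ip_comm: "\<And>V W. ip g V W = ip g W V"
    and orth: "X \<bullet> log_form p = 0" "X \<bullet> twist_form p = 0" "X \<bullet> K = 0" "X \<bullet> S = 0"
    and riccati: "k + ip g K K + ip g S S = 0"
  shows "X \<bullet> energy_source g K k S s p v = 0"
proof -
  have k: "k = - ip g K K - ip g S S" using riccati by simp
  have dist: "y v* (P - Q) = y v* P - y v* Q" "y v* (c *\<^sub>R P) = c *\<^sub>R (y v* P)"
    for y :: "real^4" and P Q :: "real^4^4" and c :: real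
    by (simp_all add: vec_eq_iff vector_matrix_mult_def algebra_simps sum_subtractf sum_distrib_left)
  show ?thesis
    unfolding energy_source_def source_def E_form_def F_form_def N_form_def E_div_def F_div_def N_div_def
      E_curl_def F_curl_def N_curl_def dist raise_wedge k
    by (simp only: orth inner_add_right inner_diff_right inner_scaleR_right ip_linear ip_comm[of "log_form p" "twist_form p"]
        ip_comm[of K "twist_form p"] ip_comm[of K "fst (snd v)"] ip_comm[of K "snd (snd v)"]
        ip_comm[of "twist_form p" "fst (snd v)"] ip_comm[of "twist_form p" "snd (snd v)"]
        ip_comm[of S "fst (snd v)"] ip_comm[of S "snd (snd v)"] mult_zero_right) (simp add: algebra_simps)
qed

context metric_at
begin

text \<open>
  The linearized equations and the wave map equations of the background turn the divergences of the
  five one-forms into functions of the first jets; \<open>divergence_stress\<close> does the rest.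
\<close>

lemma divergence_energy_tensor:
  assumes U: "open U" "x \<in> U"
    and reg: "\<And>f y. f \<in> {A, B, \<phi>, \<psi>} \<Longrightarrow> y \<in> U \<Longrightarrow> f differentiable (at y)"
      "\<And>f i. f \<in> {A, B, \<phi>, \<psi>} \<Longrightarrow> pd i f differentiable (at x)"
    and A: "\<And>y. y \<in> U \<Longrightarrow> A y \<noteq> 0"
    and wave_A: "A x * wave_op G A x = ip (G x) (differential A x) (differential A x)
        - ip (G x) (differential B x) (differential B x)"
    and wave_B: "A x * wave_op G B x = 2 * ip (G x) (differential A x) (differential B x)"
    and lin: "linearized_equations G A B \<phi> \<psi> x"
    and K: "K differentiable (at x)" "ext_deriv K x = 0"
    and S: "S differentiable (at x)" "ext_deriv S x = 0"
  defines "p \<equiv> jet1 A B" and "v \<equiv> jet1 \<phi> \<psi>"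
  shows "(\<lambda>y. energy_tensor (G y) (K y) (S y) (p y) (v y)) differentiable (at x)"
    and "divergence G (\<lambda>y. energy_tensor (G y) (K y) (S y) (p y) (v y)) x =
      energy_source (G x) (K x) (codiv G K x) (S x) (codiv G S x) (p x) (v x)"
proof -
  have df: "A differentiable (at x)" "B differentiable (at x)" "\<phi> differentiable (at x)" "\<psi> differentiable (at x)"
    using reg(1) U(2) by auto
  have dd: "differential f differentiable (at x)" if "f \<in> {A, B, \<phi>, \<psi>}" for f
    using reg(2)[OF that] by (intro differentiable_vecI) (simp add: differential_def)
  note dd' = dd[of A, simplified] dd[of B, simplified] dd[of \<phi>, simplified] dd[of \<psi>, simplified]
  have ed: "ext_deriv (differential f) x = 0" if "f \<in> {A, B, \<phi>, \<psi>}" for f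
    using ext_deriv_differential[OF U reg(1)[OF that] reg(2)[OF that]] .
  note ed' = ed[of A, simplified] ed[of B, simplified] ed[of \<phi>, simplified] ed[of \<psi>, simplified]
  have A0: "A x \<noteq> 0" using A U by simp
  have dA: "(\<lambda>y. 1 / A y) differentiable (at x)"
    using df A0 by (intro differentiable_divide) auto
  have diff_inv_A: "differential (\<lambda>y. 1 / A y) x = - (1 / (A x)\<^sup>2) *\<^sub>R differential A x"
  proof -
    have "pd i (\<lambda>y. 1 / A y * A y) x = pd i (\<lambda>y. 1) x" for i
    proof (rule pd_cong)
      show "\<forall>\<^sub>F y in nhds x. 1 / A y * A y = 1"
        using eventually_nhds_in_open[OF U] A by (auto elim!: eventually_mono)
    qed
    then have "pd i (\<lambda>y. 1 / A y) x * A x + 1 / A x * pd i A x = 0" for i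
      using pd_mult[OF dA df(1)] by simp
    then have "pd i (\<lambda>y. 1 / A y) x = - (1 / (A x)\<^sup>2) * pd i A x" for i
      using A0 by (simp add: field_simps power2_eq_square) (metis add.commute add_eq_0_iff mult.commute)
    then show ?thesis by (simp add: differential_def vec_eq_iff)
  qed
  define C where "C y = (1 / A y) *\<^sub>R differential B y" for y
  define D where "D y = (1 / A y) *\<^sub>R differential A y" for y
  have dC: "C differentiable (at x)" and dD: "D differentiable (at x)"
    unfolding C_def D_def by (intro differentiable_scaleR dA dd'(1,2))+
  have codivC: "codiv G C x = ip (G x) (C x) (D x)"
    unfolding C_def D_def codiv_scale[OF dA dd'(2)] diff_inv_A wave_op_eq_codiv[symmetric]
    using wave_B A0 by (simp add: ip_linear ip_minus field_simps power2_eq_square ip_commute)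
  have wave_A': "wave_op G A x = (ip (G x) (differential A x) (differential A x)
        - ip (G x) (differential B x) (differential B x)) / A x"
    using wave_A A0 by (simp add: field_simps)
  have codivD: "codiv G D x = - ip (G x) (C x) (C x)"
    unfolding C_def D_def codiv_scale[OF dA dd'(1)] diff_inv_A wave_op_eq_codiv[symmetric]
    by (simp add: wave_A' ip_linear ip_minus diff_divide_distrib power2_eq_square)
  have extC: "ext_deriv C x = - wedge (D x) (C x)"
    unfolding C_def D_def ext_deriv_scale[OF dA dd'(2)] diff_inv_A ed'
    by (simp add: wedge_def vec_eq_iff power2_eq_square field_simps)
  have extD: "ext_deriv D x = 0"
    unfolding D_def ext_deriv_scale[OF dA dd'(1)] diff_inv_A ed'
    by (simp add: wedge_def vec_eq_iff power2_eq_square field_simps)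
  have wave_phi: "codiv G (differential \<phi>) x = - 2 * ip (G x) (C x) (differential \<psi> x)
      + 2 * ip (G x) (C x) (C x) * \<phi> x - 2 * ip (G x) (C x) (D x) * \<psi> x"
    and wave_psi: "codiv G (differential \<psi>) x = 2 * ip (G x) (C x) (differential \<phi> x)
      + (ip (G x) (D x) (D x) + ip (G x) (C x) (C x)) * \<psi> x"
    using lin unfolding linearized_equations_def Let_def covector_inner_eq_ip wave_op_eq_codiv C_def D_def
    by (simp_all add: ip_linear power2_eq_square algebra_simps add_divide_distrib)
  define E where "E y = differential \<phi> y + \<psi> y *\<^sub>R C y - \<phi> y *\<^sub>R K y" for y
  define F where "F y = differential \<psi> y - \<phi> y *\<^sub>R C y - \<psi> y *\<^sub>R K y" for y
  define N where "N y = \<phi> y *\<^sub>R C y - \<psi> y *\<^sub>R D y" for y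
  have tensor: "(\<lambda>y. energy_tensor (G y) (K y) (S y) (p y) (v y)) =
      (\<lambda>y. stress (G y) (E y) + stress (G y) (F y) + stress (G y) (N y)
        + stress (G y) (\<phi> y *\<^sub>R S y) + stress (G y) (\<psi> y *\<^sub>R S y))"
    by (simp add: energy_tensor_def E_form_def F_form_def N_form_def twist_form_def log_form_def
        E_def F_def N_def C_def D_def p_def v_def jet1_def)
  note sc = differentiable_scaleR
  have dE: "E differentiable (at x)" and dF: "F differentiable (at x)" and dN: "N differentiable (at x)"
    and dS1: "(\<lambda>y. \<phi> y *\<^sub>R S y) differentiable (at x)" and dS2: "(\<lambda>y. \<psi> y *\<^sub>R S y) differentiable (at x)"
    unfolding E_def F_def N_def
    by (intro differentiable_add differentiable_diff sc df dd' dC dD K S)+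
  note st = differentiable_stress[OF dE] differentiable_stress[OF dF] differentiable_stress[OF dN]
    differentiable_stress[OF dS1] differentiable_stress[OF dS2]
  show "(\<lambda>y. energy_tensor (G y) (K y) (S y) (p y) (v y)) differentiable (at x)"
    unfolding tensor by (intro differentiable_add st)
  have pv: "twist_form (p x) = C x" "log_form (p x) = D x" "fst (fst (v x)) = \<phi> x" "snd (fst (v x)) = \<psi> x"
    "fst (snd (v x)) = differential \<phi> x" "snd (snd (v x)) = differential \<psi> x"
    by (simp_all add: twist_form_def log_form_def p_def v_def jet1_def C_def D_def)
  have cod: "codiv G E x = E_div (G x) (K x) (codiv G K x) (p x) (v x)"
    "codiv G F x = F_div (G x) (K x) (codiv G K x) (p x) (v x)"
    "codiv G N x = N_div (G x) (p x) (v x)"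
    "codiv G (\<lambda>y. \<phi> y *\<^sub>R S y) x = ip (G x) (S x) (differential \<phi> x) + codiv G S x * \<phi> x"
    "codiv G (\<lambda>y. \<psi> y *\<^sub>R S y) x = ip (G x) (S x) (differential \<psi> x) + codiv G S x * \<psi> x"
    unfolding E_def F_def N_def E_div_def F_div_def N_div_def pv
    by (simp_all add: codiv_add codiv_diff codiv_scale df dd' dC dD K S differentiable_add sc
        codivC codivD wave_phi wave_psi ip_commute algebra_simps)
  have ext: "ext_deriv E x = E_curl (K x) (p x) (v x)"
    "ext_deriv F x = F_curl (K x) (p x) (v x)"
    "ext_deriv N x = N_curl (p x) (v x)"
    "ext_deriv (\<lambda>y. \<phi> y *\<^sub>R S y) x = wedge (differential \<phi> x) (S x)"
    "ext_deriv (\<lambda>y. \<psi> y *\<^sub>R S y) x = wedge (differential \<psi> x) (S x)"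
    unfolding E_def F_def N_def E_curl_def F_curl_def N_curl_def pv
    by (simp_all add: ext_deriv_add ext_deriv_diff ext_deriv_scale df dd' dC dD K S differentiable_add sc
        ed' extC extD algebra_simps)
  have val: "E_form (K x) (p x) (v x) = E x" "F_form (K x) (p x) (v x) = F x" "N_form (p x) (v x) = N x"
    by (simp_all add: E_form_def F_form_def N_form_def pv E_def F_def N_def)
  show "divergence G (\<lambda>y. energy_tensor (G y) (K y) (S y) (p y) (v y)) x =
      energy_source (G x) (K x) (codiv G K x) (S x) (codiv G S x) (p x) (v x)"
    unfolding tensor energy_source_def val
    by (simp add: divergence_add st differentiable_add divergence_stress dE dF dN dS1 dS2 source_def cod ext pv)
qed

end

section \<open>The dominant energy condition in Minkowski space\<close>

text \<open>
  Here \<open>(x0, x)\<close> and \<open>(y0, y)\<close> are future timelike vectors and \<open>(v0, v)\<close> is a covector. For fixed \<open>x\<close> the expression is a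
  covector \<open>(p0, p)\<close> evaluated at \<open>y\<close>. Its square is \<open>- n\<^sup>2 / 4\<close> times the positive number \<open>x0\<^sup>2 - |x|\<^sup>2\<close>, so it
  is causal; being positive on \<open>x\<close> itself, it is positive on every future timelike vector.
\<close>

lemma lorentz_dominant_energy:
  fixes x y v :: "'a::real_inner"
  assumes x: "norm x < x0" and y: "norm y < y0" and v: "v0 \<noteq> 0 \<or> v \<noteq> 0"
  shows "(v0 * x0 + v \<bullet> x) * (v0 * y0 + v \<bullet> y) - (x \<bullet> y - x0 * y0) * (v \<bullet> v - v0\<^sup>2) / 2 > 0"
proof -
  define w where "w = v0 * x0 + v \<bullet> x"
  define n where "n = v \<bullet> v - v0\<^sup>2"
  define p0 where "p0 = w * v0 + n * x0 / 2"
  define p where "p = w *\<^sub>R v - (n / 2) *\<^sub>R x"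
  have x0: "x0 > 0" using x norm_ge_zero[of x] by linarith
  have tx: "x \<bullet> x < x0\<^sup>2"
    using x x0 by (simp add: dot_square_norm power_strict_mono)
  have "p0\<^sup>2 - p \<bullet> p = n\<^sup>2 * (x0\<^sup>2 - x \<bullet> x) / 4"
    unfolding p0_def p_def inner_diff_left inner_diff_right inner_scaleR_left inner_scaleR_right
      inner_commute[of x v] w_def n_def
    by (simp add: power2_eq_square field_simps)
  moreover have "n\<^sup>2 * (x0\<^sup>2 - x \<bullet> x) / 4 \<ge> 0" using tx by simp
  ultimately have "(norm p)\<^sup>2 \<le> p0\<^sup>2" by (simp add: power2_norm_eq_inner)
  then have np: "norm p \<le> \<bar>p0\<bar>" by (simp add: abs_le_square_iff[symmetric])
  have pos: "w\<^sup>2 + n * (x0\<^sup>2 - x \<bullet> x) / 2 > 0"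
  proof (cases "n > 0")
    case True
    then show ?thesis using tx by (simp add: add_nonneg_pos)
  next
    case False
    then have "(norm v)\<^sup>2 \<le> v0\<^sup>2" by (simp add: n_def power2_norm_eq_inner)
    then have nv: "norm v \<le> \<bar>v0\<bar>" by (simp add: abs_le_square_iff[symmetric])
    then have v0: "v0 \<noteq> 0" using v by auto
    define b where "b = \<bar>v0\<bar> * x0 - norm v * norm x"
    have "norm v * norm x \<le> \<bar>v0\<bar> * norm x" using nv by (simp add: mult_right_mono)
    also have "\<dots> < \<bar>v0\<bar> * x0" using x v0 by simp
    finally have b: "b > 0" by (simp add: b_def)
    have "\<bar>w\<bar> \<ge> \<bar>v0 * x0\<bar> - \<bar>v \<bullet> x\<bar>" unfolding w_def by linarith
    then have "\<bar>w\<bar> \<ge> b" using Cauchy_Schwarz_ineq2[of v x] x0 by (simp add: b_def abs_mult)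
    then have wb: "w\<^sup>2 \<ge> b\<^sup>2" using b by (metis abs_le_square_iff abs_of_pos)
    \<comment> \<open>The reverse Cauchy--Schwarz inequality for the two timelike or null vectors.\<close>
    have "b\<^sup>2 + n * (x0\<^sup>2 - x \<bullet> x) = (\<bar>v0\<bar> * norm x - norm v * x0)\<^sup>2"
      unfolding b_def n_def power2_norm_eq_inner[symmetric]
      by (simp add: power2_eq_square algebra_simps)
    then have "b\<^sup>2 + n * (x0\<^sup>2 - x \<bullet> x) \<ge> 0" by simp
    moreover have "b\<^sup>2 > 0" using b by simp
    ultimately show ?thesis using wb by linarith
  qed
  have "p0 * x0 + p \<bullet> x = w\<^sup>2 + n * (x0\<^sup>2 - x \<bullet> x) / 2"
  proof -
    have "v \<bullet> x = w - v0 * x0" by (simp add: w_def)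
    then show ?thesis
      unfolding p0_def p_def inner_diff_left inner_scaleR_left 
      by (simp only:) (simp add: power2_eq_square field_simps)
  qed
  with pos have px: "p0 * x0 + p \<bullet> x > 0" by simp
  have p0: "p0 > 0"
  proof (rule ccontr)
    assume "\<not> p0 > 0"
    then have "norm p \<le> - p0" "0 \<le> - p0" using np by simp_all
    then have "norm p * norm x \<le> - p0 * x0" using x by (intro mult_mono) auto
    then show False using px norm_cauchy_schwarz[of p x] by linarith
  qed
  have "- (p \<bullet> y) \<le> norm p * norm y" using Cauchy_Schwarz_ineq2[of p y] by linarith
  also have "\<dots> \<le> p0 * norm y" using np p0 by (simp add: mult_right_mono)
  also have "\<dots> < p0 * y0" using p0 y by simp
  finally have "p0 * y0 + p \<bullet> y > 0" by linarith
  also have "p0 * y0 + p \<bullet> y = w * (v0 * y0 + v \<bullet> y) - (x \<bullet> y - x0 * y0) * n / 2"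
    unfolding p0_def p_def by (simp add: inner_diff_left field_simps)
  finally show ?thesis unfolding w_def n_def .
qed

section \<open>The Kerr metric in the exterior\<close>

lemma matrix_inv_eqI:
  fixes A :: "real^'n^'n"
  assumes "A ** B = mat 1" "B ** A = mat 1"
  shows "matrix_inv A = B"
proof -
  have "A ** matrix_inv A = mat 1 \<and> matrix_inv A ** A = mat 1"
    unfolding matrix_inv_def by (rule someI[of _ B]) (use assms in auto)
  then show ?thesis
    using assms by (metis matrix_mul_assoc matrix_mul_lid matrix_mul_rid)
qed

text \<open>
  In the radial variable \<open>\<rho> = r - M\<close> the function \<open>\<Delta>\<close> becomes \<open>\<rho>\<^sup>2 - (M\<^sup>2 - a\<^sup>2)\<close>.
\<close>

definition kerr_rho :: "real \<Rightarrow> real^4 \<Rightarrow> real" where "kerr_rho M x = x $ 2 - M"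

text \<open>
  The angular velocity and the squared lapse of the observers orthogonal to the level sets of \<open>t\<close>; in
  terms of them the metric is a combination of squares (\<open>kerr_form_eq\<close>).
\<close>

definition frame_dragging :: "real \<Rightarrow> real \<Rightarrow> real^4 \<Rightarrow> real" where
  "frame_dragging M a x = 2 * a * M * x $ 2 / kerr_SS M a x"

definition lapse_sq :: "real \<Rightarrow> real \<Rightarrow> real^4 \<Rightarrow> real" where
  "lapse_sq M a x = kerr_qq a x * kerr_Delta M a x / kerr_SS M a x"

lemma kerr_form_eq:
  "kerr_form M a x X Y = - lapse_sq M a x * (X $ 3 * Y $ 3)
     + ernst_A M a x * ((X $ 4 - frame_dragging M a x * X $ 3) * (Y $ 4 - frame_dragging M a x * Y $ 3))
     + kerr_qq a x / kerr_Delta M a x * (X $ 2 * Y $ 2) + kerr_qq a x * (X $ 1 * Y $ 1)"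
  by (simp add: kerr_form_def Let_def frame_dragging_def lapse_sq_def ernst_A_eq)

lemma open_kerr_exterior: "open (kerr_exterior M a)"
proof -
  have "continuous_on UNIV (\<lambda>x::real^4. x $ i)" for i by (intro continuous_intros)
  then show ?thesis
    unfolding kerr_exterior_def
    by (intro open_Collect_conj open_Collect_less) (auto intro!: continuous_intros)
qed

lemma near_exterior:
  assumes "x \<in> kerr_exterior M a"
  shows "\<forall>\<^sub>F y in nhds x. y \<in> kerr_exterior M a"
  by (rule eventually_nhds_in_open[OF open_kerr_exterior assms])

lemma kerr_Delta_eq_rho: "kerr_Delta M a x = (kerr_rho M x)\<^sup>2 - (M\<^sup>2 - a\<^sup>2)"
  by (simp add: kerr_Delta_def kerr_rho_def power2_eq_square algebra_simps)

text \<open>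
  For \<open>r > 0\<close> this form makes the positivity of \<open>\<Sigma>\<^sup>2\<close> visible.
\<close>

lemma kerr_SS_eq: "kerr_SS M a x = ((x $ 2)\<^sup>2 + a\<^sup>2) * kerr_qq a x + 2 * M * x $ 2 * a\<^sup>2 * (sin (x $ 1))\<^sup>2"
proof -
  have "(cos (x $ 1))\<^sup>2 = 1 - (sin (x $ 1))\<^sup>2" by (simp add: cos_squared_eq)
  then show ?thesis unfolding kerr_SS_def kerr_qq_def kerr_Delta_def
    by (simp only:) (simp add: power2_eq_square algebra_simps)
qed

context
  fixes M a :: real
  assumes aM: "\<bar>a\<bar> \<le> M"
begin

lemma mass_dominates_spin: "M\<^sup>2 - a\<^sup>2 \<ge> 0"
  using aM by (metis abs_le_square_iff abs_of_nonneg abs_ge_zero diff_ge_0_iff_ge order_trans)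

context
  fixes x
  assumes x: "x \<in> kerr_exterior M a"
begin

lemma kerr_rho_pos: "kerr_rho M x > 0"
proof -
  have "0 \<le> sqrt (M\<^sup>2 - a\<^sup>2)" using mass_dominates_spin by simp
  moreover have "M + sqrt (M\<^sup>2 - a\<^sup>2) < x $ 2" using x by (simp add: kerr_exterior_def)
  ultimately show ?thesis unfolding kerr_rho_def by linarith
qed

lemma kerr_radius_pos: "x $ 2 > 0"
  using kerr_rho_pos aM by (simp add: kerr_rho_def)

lemma kerr_Delta_pos: "kerr_Delta M a x > 0"
proof -
  have "sqrt (M\<^sup>2 - a\<^sup>2) < kerr_rho M x" using x unfolding kerr_exterior_def kerr_rho_def by simp
  then have "(sqrt (M\<^sup>2 - a\<^sup>2))\<^sup>2 < (kerr_rho M x)\<^sup>2" using mass_dominates_spin by (intro power_strict_mono) auto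
  then show ?thesis using mass_dominates_spin by (simp add: kerr_Delta_eq_rho)
qed

lemma kerr_qq_pos: "kerr_qq a x > 0"
  using kerr_radius_pos unfolding kerr_qq_def by (intro add_pos_nonneg) auto

lemma sin_theta_pos: "sin (x $ 1) > 0"
  using x unfolding kerr_exterior_def by (auto intro: sin_gt_zero)

lemma kerr_SS_pos: "kerr_SS M a x > 0"
  unfolding kerr_SS_eq using kerr_radius_pos kerr_qq_pos aM by (intro add_pos_nonneg mult_pos_pos) auto

lemma lapse_sq_pos: "lapse_sq M a x > 0"
  using kerr_SS_pos kerr_qq_pos kerr_Delta_pos by (simp add: lapse_sq_def)

lemma ernst_A_pos: "ernst_A M a x > 0"
  using kerr_SS_pos kerr_qq_pos sin_theta_pos by (simp add: ernst_A_eq)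

end
end

lemma kerr_metric_entries:
  "kerr_metric M a x $ 1 $ 1 = kerr_qq a x"
  "kerr_metric M a x $ 2 $ 2 = kerr_qq a x / kerr_Delta M a x"
  "kerr_metric M a x $ 3 $ 3 = ernst_A M a x * (frame_dragging M a x)\<^sup>2 - lapse_sq M a x"
  "kerr_metric M a x $ 3 $ 4 = - ernst_A M a x * frame_dragging M a x"
  "kerr_metric M a x $ 4 $ 3 = - ernst_A M a x * frame_dragging M a x"
  "kerr_metric M a x $ 4 $ 4 = ernst_A M a x"
  "kerr_metric M a x $ 1 $ 2 = 0" "kerr_metric M a x $ 2 $ 1 = 0"
  "kerr_metric M a x $ 1 $ 3 = 0" "kerr_metric M a x $ 3 $ 1 = 0"
  "kerr_metric M a x $ 1 $ 4 = 0" "kerr_metric M a x $ 4 $ 1 = 0"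
  "kerr_metric M a x $ 2 $ 3 = 0" "kerr_metric M a x $ 3 $ 2 = 0"
  "kerr_metric M a x $ 2 $ 4 = 0" "kerr_metric M a x $ 4 $ 2 = 0"
  by (simp_all add: kerr_metric_def kerr_form_eq axis_def power2_eq_square)

definition kerr_inverse :: "real \<Rightarrow> real \<Rightarrow> real^4 \<Rightarrow> real^4^4" where
  "kerr_inverse M a x = (\<chi> i j.
     (if i = 1 then axis 1 (1 / kerr_qq a x)
      else if i = 2 then axis 2 (kerr_Delta M a x / kerr_qq a x)
      else if i = 3 then axis 3 (- 1 / lapse_sq M a x) + axis 4 (- frame_dragging M a x / lapse_sq M a x)
      else axis 3 (- frame_dragging M a x / lapse_sq M a x)
        + axis 4 (1 / ernst_A M a x - (frame_dragging M a x)\<^sup>2 / lapse_sq M a x)) $ j)"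

lemma kerr_inverse_entries:
  "kerr_inverse M a x $ 1 $ 1 = 1 / kerr_qq a x"
  "kerr_inverse M a x $ 2 $ 2 = kerr_Delta M a x / kerr_qq a x"
  "kerr_inverse M a x $ 3 $ 3 = - 1 / lapse_sq M a x"
  "kerr_inverse M a x $ 3 $ 4 = - frame_dragging M a x / lapse_sq M a x"
  "kerr_inverse M a x $ 4 $ 3 = - frame_dragging M a x / lapse_sq M a x"
  "kerr_inverse M a x $ 4 $ 4 = 1 / ernst_A M a x - (frame_dragging M a x)\<^sup>2 / lapse_sq M a x"
  "kerr_inverse M a x $ 1 $ 2 = 0" "kerr_inverse M a x $ 2 $ 1 = 0"
  "kerr_inverse M a x $ 1 $ 3 = 0" "kerr_inverse M a x $ 3 $ 1 = 0"
  "kerr_inverse M a x $ 1 $ 4 = 0" "kerr_inverse M a x $ 4 $ 1 = 0"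
  "kerr_inverse M a x $ 2 $ 3 = 0" "kerr_inverse M a x $ 3 $ 2 = 0"
  "kerr_inverse M a x $ 2 $ 4 = 0" "kerr_inverse M a x $ 4 $ 2 = 0"
  by (simp_all add: kerr_inverse_def axis_def)

lemma kerr_form_eq_metric: "X \<bullet> (kerr_metric M a x *v Y) = kerr_form M a x X Y"
  by (simp add: inner_vec_def matrix_vector_mult_def sum_4 kerr_metric_entries kerr_form_eq
      power2_eq_square algebra_simps)

context
  fixes M a :: real
  assumes aM: "\<bar>a\<bar> \<le> M"
begin

lemma kerr_inverse_works:
  assumes x: "x \<in> kerr_exterior M a"
  shows "kerr_metric M a x ** kerr_inverse M a x = mat 1"
    and "kerr_inverse M a x ** kerr_metric M a x = mat 1"
  using kerr_qq_pos[OF aM x] kerr_Delta_pos[OF aM x] lapse_sq_pos[OF aM x] ernst_A_pos[OF aM x]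
  by (simp_all add: vec_eq_iff forall_4 matrix_matrix_mult_def sum_4 kerr_metric_entries
      kerr_inverse_entries mat_def power2_eq_square field_simps)

lemma matrix_inv_kerr:
  assumes "x \<in> kerr_exterior M a"
  shows "matrix_inv (kerr_metric M a x) = kerr_inverse M a x"
  using kerr_inverse_works[OF assms] by (rule matrix_inv_eqI)

lemma ip_kerr:
  assumes "x \<in> kerr_exterior M a"
  shows "ip (kerr_metric M a x) V W = V $ 1 * W $ 1 / kerr_qq a x + kerr_Delta M a x * (V $ 2 * W $ 2) / kerr_qq a x
    + V $ 4 * W $ 4 / ernst_A M a x
    - (V $ 3 + frame_dragging M a x * V $ 4) * (W $ 3 + frame_dragging M a x * W $ 4) / lapse_sq M a x"
  unfolding ip_expand matrix_inv_kerr[OF assms]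
  by (simp add: sum_4 kerr_inverse_entries power2_eq_square algebra_simps add_divide_distrib diff_divide_distrib)

end

lemma differentiable_coord: "(\<lambda>y::real^4. y $ i) differentiable F"
  by (rule differentiable_vec_nth) simp

lemma has_derivative_coord: "((\<lambda>y::real^4. y $ i) has_derivative (\<lambda>h. h $ i)) F"
  by (rule bounded_linear.has_derivative[OF bounded_linear_vec_nth has_derivative_ident])

lemma differentiable_trig:
  "(\<lambda>y::real^4. sin (y $ i)) differentiable (at x)" "(\<lambda>y::real^4. cos (y $ i)) differentiable (at x)"
proof -
  note c = has_derivative_coord[of i]
  show "(\<lambda>y::real^4. sin (y $ i)) differentiable (at x)" "(\<lambda>y::real^4. cos (y $ i)) differentiable (at x)"
    using has_derivative_sin[OF c] has_derivative_cos[OF c] unfolding differentiable_def by blast+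
qed

lemmas differentiable_rules = differentiable_coord differentiable_trig differentiable_add differentiable_diff
  differentiable_minus differentiable_mult differentiable_divide differentiable_power differentiable_const

context
  fixes M a :: real
  assumes aM: "\<bar>a\<bar> \<le> M"
begin

context
  fixes x
  assumes x: "x \<in> kerr_exterior M a"
begin

lemma differentiable_kerr:
  "kerr_qq a differentiable (at x)" "kerr_Delta M a differentiable (at x)"
  "kerr_SS M a differentiable (at x)" "frame_dragging M a differentiable (at x)"
  "lapse_sq M a differentiable (at x)" "ernst_A M a differentiable (at x)" "ernst_B M a differentiable (at x)"
proof -
  note ne = less_imp_neq[OF kerr_qq_pos[OF aM x], symmetric] less_imp_neq[OF kerr_SS_pos[OF aM x], symmetric]
  show q: "kerr_qq a differentiable (at x)"
    unfolding kerr_qq_def[abs_def] by (intro differentiable_rules)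
  show D: "kerr_Delta M a differentiable (at x)"
    unfolding kerr_Delta_def[abs_def] by (intro differentiable_rules)
  show S: "kerr_SS M a differentiable (at x)"
    unfolding kerr_SS_def[abs_def] by (intro differentiable_rules D)
  show "frame_dragging M a differentiable (at x)"
    unfolding frame_dragging_def[abs_def] by (intro differentiable_rules S ne)
  show "lapse_sq M a differentiable (at x)"
    unfolding lapse_sq_def[abs_def] by (intro differentiable_rules q D S ne)
  show "ernst_A M a differentiable (at x)"
    unfolding ernst_A_eq[abs_def] by (intro differentiable_rules q S ne)
  show "ernst_B M a differentiable (at x)"
    unfolding ernst_B_def[abs_def] by (intro differentiable_rules q ne)
qed

lemma metric_at_kerr: "metric_at (kerr_metric M a) x"
proof
  note near = near_exterior[OF x]
  show "kerr_metric M a y $ i $ j = kerr_metric M a y $ j $ i" for y i j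
    unfolding kerr_metric_def kerr_form_eq by (simp add: mult.commute)
  show "\<forall>\<^sub>F y in nhds x. matrix_inv (kerr_metric M a y) ** kerr_metric M a y = mat 1 \<and>
      kerr_metric M a y ** matrix_inv (kerr_metric M a y) = mat 1"
    using near by eventually_elim (simp add: matrix_inv_kerr[OF aM] kerr_inverse_works[OF aM])
  note ne = less_imp_neq[OF kerr_qq_pos[OF aM x], symmetric] less_imp_neq[OF kerr_Delta_pos[OF aM x], symmetric]
    less_imp_neq[OF lapse_sq_pos[OF aM x], symmetric] less_imp_neq[OF ernst_A_pos[OF aM x], symmetric]
  have "\<forall>i j. (\<lambda>y. kerr_metric M a y $ i $ j) differentiable (at x)"
    unfolding forall_4 kerr_metric_entries
    by (intro conjI differentiable_rules differentiable_kerr ne)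
  then show "(\<lambda>y. kerr_metric M a y $ i $ j) differentiable (at x)" for i j by blast
  have "\<forall>i j. (\<lambda>y. kerr_inverse M a y $ i $ j) differentiable (at x)"
    unfolding forall_4 kerr_inverse_entries
    by (intro conjI differentiable_rules differentiable_kerr ne)
  then have inv: "(\<lambda>y. kerr_inverse M a y $ i $ j) differentiable (at x)" for i j by blast
  have "\<forall>\<^sub>F y in nhds x. kerr_inverse M a y $ i $ j = matrix_inv (kerr_metric M a y) $ i $ j" for i j
    using near by eventually_elim (simp add: matrix_inv_kerr[OF aM])
  then show "(\<lambda>y. matrix_inv (kerr_metric M a y) $ i $ j) differentiable (at x)" for i j
    using inv by (rule differentiable_cong_nhds)
qed

lemma pd_Delta_sin:
  "pd 1 (\<lambda>y. kerr_Delta M a y * (sin (y $ 1))\<^sup>2) x = 2 * kerr_Delta M a x * sin (x $ 1) * cos (x $ 1)"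
  "pd 2 (\<lambda>y. kerr_Delta M a y * (sin (y $ 1))\<^sup>2) x = 2 * kerr_rho M x * (sin (x $ 1))\<^sup>2"
  "pd 1 (kerr_Delta M a) x = 0" "pd 2 (kerr_Delta M a) x = 2 * kerr_rho M x"
proof -
  note c = has_derivative_coord
  have D: "(kerr_Delta M a has_derivative (\<lambda>h. 2 * kerr_rho M x * h $ 2)) (at x)"
    unfolding kerr_Delta_def[abs_def] kerr_rho_def
    by (auto intro!: derivative_eq_intros c simp: algebra_simps)
  have "((\<lambda>y. kerr_Delta M a y * (sin (y $ 1))\<^sup>2) has_derivative
      (\<lambda>h. kerr_Delta M a x * (2 * sin (x $ 1) * cos (x $ 1) * h $ 1) + 2 * kerr_rho M x * h $ 2 * (sin (x $ 1))\<^sup>2)) (at x)"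
    by (auto intro!: derivative_eq_intros c D simp: algebra_simps)
  from pd_eqI[OF this] pd_eqI[OF D]
  show "pd 1 (\<lambda>y. kerr_Delta M a y * (sin (y $ 1))\<^sup>2) x = 2 * kerr_Delta M a x * sin (x $ 1) * cos (x $ 1)"
    "pd 2 (\<lambda>y. kerr_Delta M a y * (sin (y $ 1))\<^sup>2) x = 2 * kerr_rho M x * (sin (x $ 1))\<^sup>2"
    "pd 1 (kerr_Delta M a) x = 0" "pd 2 (kerr_Delta M a) x = 2 * kerr_rho M x"
    by (simp_all add: axis_def)
qed

text \<open>
  The classical formula \<open>q\<^sup>2 div V = d\<^sub>\<theta> V\<^sub>\<theta> + cot \<theta> V\<^sub>\<theta> + d\<^sub>r (\<Delta> V\<^sub>r)\<close> for one-forms without \<open>t\<close> and \<open>\<phi>\<close>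
  components. The \<open>(t, \<phi>)\<close> block of the metric enters the contracted Christoffel symbols only through the
  logarithmic derivative of its determinant, which is \<open>- \<Delta> sin\<^sup>2 \<theta>\<close>; hence its entries are never
  differentiated explicitly.
\<close>

lemma codiv_kerr:
  assumes V: "\<forall>\<^sub>F y in nhds x. V y $ 3 = 0 \<and> V y $ 4 = 0"
  shows "codiv (kerr_metric M a) V x =
    (pd 1 (\<lambda>y. V y $ 1) x + cos (x $ 1) / sin (x $ 1) * V x $ 1
      + kerr_Delta M a x * pd 2 (\<lambda>y. V y $ 2) x + 2 * kerr_rho M x * V x $ 2) / kerr_qq a x"
proof -
  interpret metric_at "kerr_metric M a" x by (rule metric_at_kerr)
  let ?g = "kerr_metric M a" and ?q = "kerr_qq a x" and ?D = "kerr_Delta M a x"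
  define P where "P k i j = pd k (\<lambda>y. ?g y $ i $ j) x" for k i j
  have q: "?q > 0" and D: "?D > 0" and s: "sin (x $ 1) > 0" and A: "ernst_A M a x > 0" and L: "lapse_sq M a x > 0"
    using kerr_qq_pos[OF aM x] kerr_Delta_pos[OF aM x] sin_theta_pos[OF aM x] ernst_A_pos[OF aM x] lapse_sq_pos[OF aM x] by auto
  have V0: "V x $ 3 = 0" "V x $ 4 = 0" using eventually_nhds_x_imp_x[OF V] by auto
  have "\<forall>\<^sub>F y in nhds x. V y $ 3 = 0" "\<forall>\<^sub>F y in nhds x. V y $ 4 = 0"
    using V by (auto elim: eventually_mono)
  then have pdV0: "pd k (\<lambda>y. V y $ 3) x = 0" "pd k (\<lambda>y. V y $ 4) x = 0" for k
    using pd_cong[where g = "\<lambda>y. 0"] by auto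
  note near = near_exterior[OF x]
  have det: "lapse_sq M a y * ernst_A M a y = kerr_Delta M a y * (sin (y $ 1))\<^sup>2" if "y \<in> kerr_exterior M a" for y
    using kerr_qq_pos[OF aM that] kerr_SS_pos[OF aM that] by (simp add: lapse_sq_def ernst_A_eq)
  have Pdet: "P k 3 3 * ?g x $ 4 $ 4 + ?g x $ 3 $ 3 * P k 4 4 - 2 * ?g x $ 3 $ 4 * P k 3 4
      = - pd k (\<lambda>y. kerr_Delta M a y * (sin (y $ 1))\<^sup>2) x" for k
  proof -
    have "pd k (\<lambda>y. ?g y $ 3 $ 4 * ?g y $ 3 $ 4 - ?g y $ 3 $ 3 * ?g y $ 4 $ 4) x =
        pd k (\<lambda>y. kerr_Delta M a y * (sin (y $ 1))\<^sup>2) x"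
    proof (rule pd_cong)
      show "\<forall>\<^sub>F y in nhds x. ?g y $ 3 $ 4 * ?g y $ 3 $ 4 - ?g y $ 3 $ 3 * ?g y $ 4 $ 4 =
          kerr_Delta M a y * (sin (y $ 1))\<^sup>2"
        using near
      proof eventually_elim
        case (elim y)
        show ?case
          using det[OF elim] by (simp add: kerr_metric_entries power2_eq_square algebra_simps)
      qed
    qed
    then show ?thesis
      unfolding pd_diff[OF differentiable_mult[OF g_differentiable g_differentiable] differentiable_mult[OF g_differentiable g_differentiable]]
        pd_mult[OF g_differentiable g_differentiable] P_def by simp
  qed
  have h: "1 / ernst_A M a x - (frame_dragging M a x)\<^sup>2 / lapse_sq M a x = - ?g x $ 3 $ 3 / (?D * (sin (x $ 1))\<^sup>2)"
    "- 1 / lapse_sq M a x = - ?g x $ 4 $ 4 / (?D * (sin (x $ 1))\<^sup>2)"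
    "- frame_dragging M a x / lapse_sq M a x = ?g x $ 3 $ 4 / (?D * (sin (x $ 1))\<^sup>2)"
    unfolding det[OF x, symmetric] kerr_metric_entries using A L
    by (simp_all add: field_simps power2_eq_square)
  \<comment> \<open>The trace of the inverse block times the derivative of the block is the logarithmic derivative of the determinant.\<close>
  have trace: "- 1 / lapse_sq M a x * P k 3 3 + 2 * (- frame_dragging M a x / lapse_sq M a x) * P k 3 4
      + (1 / ernst_A M a x - (frame_dragging M a x)\<^sup>2 / lapse_sq M a x) * P k 4 4 =
      pd k (\<lambda>y. kerr_Delta M a y * (sin (y $ 1))\<^sup>2) x / (?D * (sin (x $ 1))\<^sup>2)" for k
  proof -
    have "- 1 / lapse_sq M a x * P k 3 3 + 2 * (- frame_dragging M a x / lapse_sq M a x) * P k 3 4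
      + (1 / ernst_A M a x - (frame_dragging M a x)\<^sup>2 / lapse_sq M a x) * P k 4 4 =
      - (P k 3 3 * ?g x $ 4 $ 4 + ?g x $ 3 $ 3 * P k 4 4 - 2 * ?g x $ 3 $ 4 * P k 3 4) / (?D * (sin (x $ 1))\<^sup>2)"
      unfolding h by (simp add: add_divide_distrib diff_divide_distrib algebra_simps)
    then show ?thesis unfolding Pdet by simp
  qed
  have tr1: "pd 1 (\<lambda>y. kerr_Delta M a y * (sin (y $ 1))\<^sup>2) x / (?D * (sin (x $ 1))\<^sup>2) = 2 * cos (x $ 1) / sin (x $ 1)"
    and tr2: "pd 2 (\<lambda>y. kerr_Delta M a y * (sin (y $ 1))\<^sup>2) x / (?D * (sin (x $ 1))\<^sup>2) = 2 * kerr_rho M x / ?D"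
    unfolding pd_Delta_sin using D s by (simp_all add: power2_eq_square)
  have Pq: "P k 1 1 = P k 2 2 * ?D + ?q / ?D * pd k (kerr_Delta M a) x" for k
  proof -
    have "P k 1 1 = pd k (\<lambda>y. ?g y $ 2 $ 2 * kerr_Delta M a y) x"
      unfolding P_def
    proof (rule pd_cong)
      show "\<forall>\<^sub>F y in nhds x. ?g y $ 1 $ 1 = ?g y $ 2 $ 2 * kerr_Delta M a y"
        using near
      proof eventually_elim
        case (elim y)
        then show ?case using kerr_Delta_pos[OF aM elim] by (simp add: kerr_metric_entries)
      qed
    qed
    then show ?thesis
      unfolding pd_mult[OF g_differentiable differentiable_kerr(2)] by (simp add: P_def kerr_metric_entries)
  qed
  have Pk22: "P 1 2 2 = P 1 1 1 / ?D" "P 2 2 2 = (P 2 1 1 - 2 * kerr_rho M x * ?q / ?D) / ?D"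
    using Pq[of 1] Pq[of 2] D unfolding pd_Delta_sin by (simp_all add: field_simps)
  have P0: "P k 1 2 = 0" "P k 2 1 = 0" "P k 1 3 = 0" "P k 3 1 = 0" "P k 1 4 = 0" "P k 4 1 = 0"
    "P k 2 3 = 0" "P k 3 2 = 0" "P k 2 4 = 0" "P k 4 2 = 0" "P k 4 3 = P k 3 4" for k
    by (simp_all add: P_def kerr_metric_entries)
  let ?H = "kerr_inverse M a x"
  let ?t = "\<lambda>k. ?H $ 3 $ 3 * P k 3 3 + 2 * ?H $ 3 $ 4 * P k 3 4 + ?H $ 4 $ 4 * P k 4 4"
  have t: "?t k = pd k (\<lambda>y. kerr_Delta M a y * (sin (y $ 1))\<^sup>2) x / (?D * (sin (x $ 1))\<^sup>2)" for k
    using trace[of k] unfolding kerr_inverse_entries .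
  have H0: "?H $ 1 $ 2 = 0" "?H $ 2 $ 1 = 0" "?H $ 1 $ 3 = 0" "?H $ 3 $ 1 = 0" "?H $ 1 $ 4 = 0" "?H $ 4 $ 1 = 0"
    "?H $ 2 $ 3 = 0" "?H $ 3 $ 2 = 0" "?H $ 2 $ 4 = 0" "?H $ 4 $ 2 = 0" "?H $ 4 $ 3 = ?H $ 3 $ 4"
    by (simp_all only: kerr_inverse_entries)
  have chr: "christoffel ?g x k i j = (\<Sum>l\<in>UNIV. ?H $ k $ l * (P i j l + P j i l - P l i j)) / 2" for k i j
    by (simp add: christoffel_def P_def matrix_inv_kerr[OF aM x])
  have "codiv ?g V x = ?H $ 1 $ 1 * pd 1 (\<lambda>y. V y $ 1) x + ?H $ 2 $ 2 * pd 2 (\<lambda>y. V y $ 2) x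
     - V x $ 1 * ?H $ 1 $ 1 / 2 * (?H $ 1 $ 1 * P 1 1 1 - ?H $ 2 $ 2 * P 1 2 2 - ?t 1)
     - V x $ 2 * ?H $ 2 $ 2 / 2 * (?H $ 2 $ 2 * P 2 2 2 - ?H $ 1 $ 1 * P 2 1 1 - ?t 2)"
    unfolding codiv_def cov_deriv1_def matrix_inv_kerr[OF aM x] chr sum_4 H0 P0 V0 pdV0
    by (simp add: algebra_simps add_divide_distrib diff_divide_distrib)
  then show ?thesis
    unfolding t tr1 tr2 Pk22 unfolding kerr_inverse_entries using q D s
    by (simp add: field_simps)
qed

end
end

section \<open>The wave map equations for the Ernst potential\<close>

text \<open>
  The real and minus the imaginary part of \<open>w = 1 / (r + i a cos \<theta>)\<close>. The Ernst potential is polynomial in \<open>r\<close>,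
  \<open>sin \<theta>\<close>, \<open>cos \<theta>\<close>, \<open>u\<close>, \<open>v\<close>, and so are all its derivatives, because \<open>dw = - w\<^sup>2 d(r + i a cos \<theta>)\<close>. The
  relations \<open>pot_relations\<close> express \<open>w (r + i a cos \<theta>) = 1\<close>. This turns the wave map equations into a
  polynomial identity modulo three relations.
\<close>

definition pot_u :: "real \<Rightarrow> real^4 \<Rightarrow> real" where "pot_u a x = x $ 2 / kerr_qq a x"

definition pot_v :: "real \<Rightarrow> real^4 \<Rightarrow> real" where "pot_v a x = a * cos (x $ 1) / kerr_qq a x"

text \<open>
  The candidates for the first partial derivatives of the Ernst potential (see \<open>pd_ernst\<close>).
\<close>

definition A_theta :: "real \<Rightarrow> real \<Rightarrow> real^4 \<Rightarrow> real" where
  "A_theta M a x = (let s = sin (x $ 1); c = cos (x $ 1); r = x $ 2; u = pot_u a x; v = pot_v a x in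
     2 * (r\<^sup>2 + a\<^sup>2) * s * c + 8 * M * a\<^sup>2 * s ^ 3 * c * u + 4 * M * a ^ 3 * s ^ 5 * u * v)"

definition A_r :: "real \<Rightarrow> real \<Rightarrow> real^4 \<Rightarrow> real" where
  "A_r M a x = (let s = sin (x $ 1); r = x $ 2; u = pot_u a x; v = pot_v a x in
     2 * r * s\<^sup>2 + 2 * M * a\<^sup>2 * s ^ 4 * (v\<^sup>2 - u\<^sup>2))"

definition B_theta :: "real \<Rightarrow> real \<Rightarrow> real^4 \<Rightarrow> real" where
  "B_theta M a x = (let s = sin (x $ 1); c = cos (x $ 1); u = pot_u a x; v = pot_v a x in
     6 * a * M * s ^ 3 - 8 * M * a\<^sup>2 * s ^ 3 * c * v + 2 * M * a ^ 3 * s ^ 5 * (u\<^sup>2 - v\<^sup>2))"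

definition B_r :: "real \<Rightarrow> real \<Rightarrow> real^4 \<Rightarrow> real" where
  "B_r M a x = (let s = sin (x $ 1); u = pot_u a x; v = pot_v a x in 4 * M * a\<^sup>2 * s ^ 4 * u * v)"

lemma ernst_A_potential:
  assumes "kerr_qq a x > 0"
  shows "ernst_A M a x = ((x $ 2)\<^sup>2 + a\<^sup>2) * (sin (x $ 1))\<^sup>2 + 2 * M * a\<^sup>2 * (sin (x $ 1)) ^ 4 * pot_u a x"
  using assms unfolding ernst_A_eq kerr_SS_eq pot_u_def by (simp add: field_simps power2_eq_square power_numeral_reduce)

lemma ernst_B_potential:
  "ernst_B M a x = - 2 * a * M * (3 * cos (x $ 1) - (cos (x $ 1)) ^ 3) - 2 * M * a\<^sup>2 * (sin (x $ 1)) ^ 4 * pot_v a x"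
  unfolding ernst_B_def pot_v_def by (simp add: power2_eq_square power3_eq_cube algebra_simps)

lemma pot_relations:
  assumes "kerr_qq a x > 0"
  shows "x $ 2 * pot_u a x + a * cos (x $ 1) * pot_v a x = 1"
    and "x $ 2 * pot_v a x = a * cos (x $ 1) * pot_u a x"
proof -
  have "(x $ 2 * x $ 2 + a * cos (x $ 1) * (a * cos (x $ 1))) / kerr_qq a x = 1"
    using assms unfolding kerr_qq_def by (simp add: power2_eq_square algebra_simps)
  then show "x $ 2 * pot_u a x + a * cos (x $ 1) * pot_v a x = 1"
    by (simp add: pot_u_def pot_v_def add_divide_distrib)
qed (simp add: pot_u_def pot_v_def)

lemma has_derivative_pot:
  assumes q: "kerr_qq a x > 0"
  shows "(pot_u a has_derivative (\<lambda>h. 2 * a * sin (x $ 1) * pot_u a x * pot_v a x * h $ 1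
      + ((pot_v a x)\<^sup>2 - (pot_u a x)\<^sup>2) * h $ 2)) (at x)"
    and "(pot_v a has_derivative (\<lambda>h. - a * sin (x $ 1) * ((pot_u a x)\<^sup>2 - (pot_v a x)\<^sup>2) * h $ 1
      - 2 * pot_u a x * pot_v a x * h $ 2)) (at x)"
proof -
  have dq: "(kerr_qq a has_derivative (\<lambda>h. 2 * x $ 2 * h $ 2 - 2 * a\<^sup>2 * cos (x $ 1) * sin (x $ 1) * h $ 1)) (at x)"
    unfolding kerr_qq_def[abs_def] by (auto intro!: derivative_eq_intros has_derivative_coord simp: algebra_simps)
  have du: "(pot_u a has_derivative (\<lambda>h. (h $ 2 * kerr_qq a x
      - x $ 2 * (2 * x $ 2 * h $ 2 - 2 * a\<^sup>2 * cos (x $ 1) * sin (x $ 1) * h $ 1)) / (kerr_qq a x)\<^sup>2)) (at x)"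
    unfolding pot_u_def[abs_def] using q
    by (auto intro!: derivative_eq_intros has_derivative_coord dq simp: power2_eq_square)
  have dv: "(pot_v a has_derivative (\<lambda>h. (- a * sin (x $ 1) * h $ 1 * kerr_qq a x
      - a * cos (x $ 1) * (2 * x $ 2 * h $ 2 - 2 * a\<^sup>2 * cos (x $ 1) * sin (x $ 1) * h $ 1)) / (kerr_qq a x)\<^sup>2)) (at x)"
    unfolding pot_v_def[abs_def] using q
    by (auto intro!: derivative_eq_intros has_derivative_coord dq simp: power2_eq_square)
  define q U V where "q = kerr_qq a x" and "U = pot_u a x" and "V = pot_v a x"
  have rel: "x $ 2 = U * q" "a * cos (x $ 1) = V * q" and q0: "q\<^sup>2 \<noteq> 0"
    using q by (simp_all add: q_def U_def V_def pot_u_def pot_v_def)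
  have one: "q * (U\<^sup>2 + V\<^sup>2) = 1"
    using pot_relations(1)[OF q] rel unfolding q_def[symmetric] U_def[symmetric] V_def[symmetric] by algebra
  have "(h $ 2 * q - x $ 2 * (2 * x $ 2 * h $ 2 - 2 * a\<^sup>2 * cos (x $ 1) * sin (x $ 1) * h $ 1)) / q\<^sup>2 =
      2 * a * sin (x $ 1) * U * V * h $ 1 + (V\<^sup>2 - U\<^sup>2) * h $ 2" for h :: "real^4"
    unfolding nonzero_divide_eq_eq[OF q0] using rel one by algebra
  then show "(pot_u a has_derivative (\<lambda>h. 2 * a * sin (x $ 1) * pot_u a x * pot_v a x * h $ 1
      + ((pot_v a x)\<^sup>2 - (pot_u a x)\<^sup>2) * h $ 2)) (at x)"
    using du unfolding q_def U_def V_def by simp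
  have "(- a * sin (x $ 1) * h $ 1 * q
      - a * cos (x $ 1) * (2 * x $ 2 * h $ 2 - 2 * a\<^sup>2 * cos (x $ 1) * sin (x $ 1) * h $ 1)) / q\<^sup>2 =
      - a * sin (x $ 1) * (U\<^sup>2 - V\<^sup>2) * h $ 1 - 2 * U * V * h $ 2" for h :: "real^4"
    unfolding nonzero_divide_eq_eq[OF q0] using rel one by algebra
  then show "(pot_v a has_derivative (\<lambda>h. - a * sin (x $ 1) * ((pot_u a x)\<^sup>2 - (pot_v a x)\<^sup>2) * h $ 1
      - 2 * pot_u a x * pot_v a x * h $ 2)) (at x)"
    using dv unfolding q_def U_def V_def by simp
qed

lemma has_derivative_A:
  assumes q: "kerr_qq a x > 0"
  shows "((\<lambda>x. ((x $ 2)\<^sup>2 + a\<^sup>2) * (sin (x $ 1))\<^sup>2 + 2 * M * a\<^sup>2 * (sin (x $ 1)) ^ 4 * pot_u a x)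
    has_derivative (\<lambda>h. A_theta M a x * h $ 1 + A_r M a x * h $ 2)) (at x)"
  unfolding A_theta_def A_r_def Let_def
  by (auto intro!: derivative_eq_intros has_derivative_coord has_derivative_pot[OF q] simp: fun_eq_iff) algebra

lemma has_derivative_B:
  assumes q: "kerr_qq a x > 0"
  shows "(ernst_B M a has_derivative (\<lambda>h. B_theta M a x * h $ 1 + B_r M a x * h $ 2)) (at x)"
proof -
  have "(sin (x $ 1))\<^sup>2 = 1 - (cos (x $ 1))\<^sup>2" by (simp add: sin_squared_eq)
  then have s3: "6 * a * M * sin (x $ 1) ^ 3 = 6 * a * M * sin (x $ 1) - 6 * a * M * sin (x $ 1) * (cos (x $ 1))\<^sup>2"
    by algebra
  show ?thesis
    unfolding B_theta_def B_r_def Let_def s3 ernst_B_potential[abs_def]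
    by (auto intro!: derivative_eq_intros has_derivative_coord has_derivative_pot[OF q] simp: fun_eq_iff) algebra
qed

context
  fixes M a :: real
  assumes aM: "\<bar>a\<bar> \<le> M"
begin

lemma pd_ernst:
  assumes x: "x \<in> kerr_exterior M a"
  shows "pd 1 (ernst_A M a) x = A_theta M a x" "pd 2 (ernst_A M a) x = A_r M a x"
    "pd 3 (ernst_A M a) x = 0" "pd 4 (ernst_A M a) x = 0"
    "pd 1 (ernst_B M a) x = B_theta M a x" "pd 2 (ernst_B M a) x = B_r M a x"
    "pd 3 (ernst_B M a) x = 0" "pd 4 (ernst_B M a) x = 0"
proof -
  note q = kerr_qq_pos[OF aM x]
  have "\<forall>\<^sub>F y in nhds x. ernst_A M a y =
      ((y $ 2)\<^sup>2 + a\<^sup>2) * (sin (y $ 1))\<^sup>2 + 2 * M * a\<^sup>2 * (sin (y $ 1)) ^ 4 * pot_u a y"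
    using near_exterior[OF x]
    by eventually_elim (simp add: ernst_A_potential kerr_qq_pos[OF aM])
  note A = pd_cong[OF this] pd_eqI[OF has_derivative_A[OF q]]
  show "pd 1 (ernst_A M a) x = A_theta M a x" "pd 2 (ernst_A M a) x = A_r M a x"
    "pd 3 (ernst_A M a) x = 0" "pd 4 (ernst_A M a) x = 0"
    by (simp_all add: A axis_def)
  show "pd 1 (ernst_B M a) x = B_theta M a x" "pd 2 (ernst_B M a) x = B_r M a x"
    "pd 3 (ernst_B M a) x = 0" "pd 4 (ernst_B M a) x = 0"
    by (simp_all add: pd_eqI[OF has_derivative_B[OF q]] axis_def)
qed

context
  fixes x
  assumes x: "x \<in> kerr_exterior M a"
begin

lemma differentiable_ernst_partials:
  "A_theta M a differentiable (at x)" "A_r M a differentiable (at x)"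
  "B_theta M a differentiable (at x)" "B_r M a differentiable (at x)"
proof -
  have u: "pot_u a differentiable (at x)" and v: "pot_v a differentiable (at x)"
    using has_derivative_pot[OF kerr_qq_pos[OF aM x]] unfolding differentiable_def by blast+
  show "A_theta M a differentiable (at x)" "A_r M a differentiable (at x)"
    "B_theta M a differentiable (at x)" "B_r M a differentiable (at x)"
    unfolding A_theta_def[abs_def] A_r_def[abs_def] B_theta_def[abs_def] B_r_def[abs_def] Let_def
    by (intro differentiable_rules u v)+
qed

lemma differentiable_pd_ernst:
  "pd i (ernst_A M a) differentiable (at x)" "pd i (ernst_B M a) differentiable (at x)"
proof -
  note near = near_exterior[OF x]
  have ev: "\<forall>\<^sub>F y in nhds x. F y = pd i f y"
    if "\<And>y. y \<in> kerr_exterior M a \<Longrightarrow> pd i f y = F y" for i f F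
    using near by eventually_elim (simp add: that)
  have d: "pd i f differentiable (at x)"
    if "\<And>y. y \<in> kerr_exterior M a \<Longrightarrow> pd i f y = F y" "F differentiable (at x)" for i f F
    using ev[OF that(1)] that(2) by (rule differentiable_cong_nhds)
  note p = differentiable_ernst_partials
  have "\<forall>i. pd i (ernst_A M a) differentiable (at x) \<and> pd i (ernst_B M a) differentiable (at x)"
    unfolding forall_4
    by (intro conjI; rule d[OF pd_ernst(1) p(1)] d[OF pd_ernst(2) p(2)]
        d[OF pd_ernst(3) differentiable_const] d[OF pd_ernst(4) differentiable_const]
        d[OF pd_ernst(5) p(3)] d[OF pd_ernst(6) p(4)]
        d[OF pd_ernst(7) differentiable_const] d[OF pd_ernst(8) differentiable_const])
  then show "pd i (ernst_A M a) differentiable (at x)" "pd i (ernst_B M a) differentiable (at x)"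
    by auto
qed

lemma wave_op_ernst:
  "wave_op (kerr_metric M a) (ernst_A M a) x =
    (pd 1 (A_theta M a) x + cos (x $ 1) / sin (x $ 1) * A_theta M a x
      + kerr_Delta M a x * pd 2 (A_r M a) x + 2 * kerr_rho M x * A_r M a x) / kerr_qq a x"
  "wave_op (kerr_metric M a) (ernst_B M a) x =
    (pd 1 (B_theta M a) x + cos (x $ 1) / sin (x $ 1) * B_theta M a x
      + kerr_Delta M a x * pd 2 (B_r M a) x + 2 * kerr_rho M x * B_r M a x) / kerr_qq a x"
proof -
  note near = near_exterior[OF x]
  have pp: "pd k (pd i f) x = pd k F x"
    if "\<And>y. y \<in> kerr_exterior M a \<Longrightarrow> pd i f y = F y" for k i f F
    by (rule pd_cong, use near in eventually_elim) (rule that)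
  have sec: "pd k (pd 1 (ernst_A M a)) x = pd k (A_theta M a) x" "pd k (pd 2 (ernst_A M a)) x = pd k (A_r M a) x"
    "pd k (pd 1 (ernst_B M a)) x = pd k (B_theta M a) x" "pd k (pd 2 (ernst_B M a)) x = pd k (B_r M a) x" for k
    by (rule pp, erule pd_ernst)+
  have comp: "(\<lambda>y. differential f y $ i) = pd i f" "differential f x $ i = pd i f x" for f i
    by (simp_all add: differential_def fun_eq_iff)
  have "\<forall>\<^sub>F y in nhds x. differential (ernst_A M a) y $ 3 = 0 \<and> differential (ernst_A M a) y $ 4 = 0"
    using near by eventually_elim (simp add: differential_def pd_ernst)
  note w = codiv_kerr[OF aM x this]
  show "wave_op (kerr_metric M a) (ernst_A M a) x =
    (pd 1 (A_theta M a) x + cos (x $ 1) / sin (x $ 1) * A_theta M a x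
      + kerr_Delta M a x * pd 2 (A_r M a) x + 2 * kerr_rho M x * A_r M a x) / kerr_qq a x"
    unfolding wave_op_eq_codiv w comp sec pd_ernst[OF x] ..
  have "\<forall>\<^sub>F y in nhds x. differential (ernst_B M a) y $ 3 = 0 \<and> differential (ernst_B M a) y $ 4 = 0"
    using near by eventually_elim (simp add: differential_def pd_ernst)
  note w = codiv_kerr[OF aM x this]
  show "wave_op (kerr_metric M a) (ernst_B M a) x =
    (pd 1 (B_theta M a) x + cos (x $ 1) / sin (x $ 1) * B_theta M a x
      + kerr_Delta M a x * pd 2 (B_r M a) x + 2 * kerr_rho M x * B_r M a x) / kerr_qq a x"
    unfolding wave_op_eq_codiv w comp sec pd_ernst[OF x] ..
qed

lemma pd_ernst_second:
  defines "s \<equiv> sin (x $ 1)" and "c \<equiv> cos (x $ 1)" and "r \<equiv> x $ 2" and "u \<equiv> pot_u a x" and "v \<equiv> pot_v a x"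
  shows "pd 1 (A_theta M a) x = 2 * (r\<^sup>2 + a\<^sup>2) * (c\<^sup>2 - s\<^sup>2)
      + 8 * M * a\<^sup>2 * ((3 * s\<^sup>2 * c\<^sup>2 - s ^ 4) * u + 2 * a * s ^ 4 * c * u * v)
      + 4 * M * a ^ 3 * (5 * s ^ 4 * c * u * v + a * s ^ 6 * (3 * u * v\<^sup>2 - u ^ 3))"
    and "pd 2 (A_r M a) x = 2 * s\<^sup>2 + 4 * M * a\<^sup>2 * s ^ 4 * (u ^ 3 - 3 * u * v\<^sup>2)"
    and "pd 1 (B_theta M a) x = 18 * a * M * s\<^sup>2 * c
      - 8 * M * a\<^sup>2 * ((3 * s\<^sup>2 * c\<^sup>2 - s ^ 4) * v - a * s ^ 4 * c * (u\<^sup>2 - v\<^sup>2))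
      + 2 * M * a ^ 3 * (5 * s ^ 4 * c * (u\<^sup>2 - v\<^sup>2) + a * s ^ 6 * (6 * u\<^sup>2 * v - 2 * v ^ 3))"
    and "pd 2 (B_r M a) x = 4 * M * a\<^sup>2 * s ^ 4 * (v ^ 3 - 3 * u\<^sup>2 * v)"
proof -
  note q = kerr_qq_pos[OF aM x]
  note intros = derivative_eq_intros has_derivative_coord has_derivative_pot[OF q]
  let ?u' = "\<lambda>h::real^4. 2 * a * s * u * v * h $ 1 + (v\<^sup>2 - u\<^sup>2) * h $ 2"
  let ?v' = "\<lambda>h::real^4. - a * s * (u\<^sup>2 - v\<^sup>2) * h $ 1 - 2 * u * v * h $ 2"
  have d: "(A_theta M a has_derivative (\<lambda>h. 4 * r * h $ 2 * s * c + 2 * (r\<^sup>2 + a\<^sup>2) * (c\<^sup>2 - s\<^sup>2) * h $ 1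
      + 8 * M * a\<^sup>2 * ((3 * s\<^sup>2 * c\<^sup>2 - s ^ 4) * u * h $ 1 + s ^ 3 * c * ?u' h)
      + 4 * M * a ^ 3 * (5 * s ^ 4 * c * u * v * h $ 1 + s ^ 5 * (?u' h * v + u * ?v' h)))) (at x)"
    unfolding A_theta_def[abs_def] Let_def s_def c_def r_def u_def v_def
    by (auto intro!: intros simp: fun_eq_iff) algebra
  show "pd 1 (A_theta M a) x = 2 * (r\<^sup>2 + a\<^sup>2) * (c\<^sup>2 - s\<^sup>2)
      + 8 * M * a\<^sup>2 * ((3 * s\<^sup>2 * c\<^sup>2 - s ^ 4) * u + 2 * a * s ^ 4 * c * u * v)
      + 4 * M * a ^ 3 * (5 * s ^ 4 * c * u * v + a * s ^ 6 * (3 * u * v\<^sup>2 - u ^ 3))"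
    unfolding pd_eqI[OF d] by (simp add: axis_def) algebra
  have d: "(A_r M a has_derivative (\<lambda>h. 2 * s\<^sup>2 * h $ 2 + 4 * r * s * c * h $ 1
      + 2 * M * a\<^sup>2 * (4 * s ^ 3 * c * (v\<^sup>2 - u\<^sup>2) * h $ 1 + s ^ 4 * (2 * v * ?v' h - 2 * u * ?u' h)))) (at x)"
    unfolding A_r_def[abs_def] Let_def s_def c_def r_def u_def v_def
    by (auto intro!: intros simp: fun_eq_iff) algebra
  show "pd 2 (A_r M a) x = 2 * s\<^sup>2 + 4 * M * a\<^sup>2 * s ^ 4 * (u ^ 3 - 3 * u * v\<^sup>2)"
    unfolding pd_eqI[OF d] by (simp add: axis_def) algebra
  have d: "(B_theta M a has_derivative (\<lambda>h. 18 * a * M * s\<^sup>2 * c * h $ 1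
      - 8 * M * a\<^sup>2 * ((3 * s\<^sup>2 * c\<^sup>2 - s ^ 4) * v * h $ 1 + s ^ 3 * c * ?v' h)
      + 2 * M * a ^ 3 * (5 * s ^ 4 * c * (u\<^sup>2 - v\<^sup>2) * h $ 1 + s ^ 5 * (2 * u * ?u' h - 2 * v * ?v' h)))) (at x)"
    unfolding B_theta_def[abs_def] Let_def s_def c_def r_def u_def v_def
    by (auto intro!: intros simp: fun_eq_iff) algebra
  show "pd 1 (B_theta M a) x = 18 * a * M * s\<^sup>2 * c
      - 8 * M * a\<^sup>2 * ((3 * s\<^sup>2 * c\<^sup>2 - s ^ 4) * v - a * s ^ 4 * c * (u\<^sup>2 - v\<^sup>2))
      + 2 * M * a ^ 3 * (5 * s ^ 4 * c * (u\<^sup>2 - v\<^sup>2) + a * s ^ 6 * (6 * u\<^sup>2 * v - 2 * v ^ 3))"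
    unfolding pd_eqI[OF d] by (simp add: axis_def) algebra
  have d: "(B_r M a has_derivative (\<lambda>h. 4 * M * a\<^sup>2 * (4 * s ^ 3 * c * u * v * h $ 1
      + s ^ 4 * (?u' h * v + u * ?v' h)))) (at x)"
    unfolding B_r_def[abs_def] Let_def s_def c_def r_def u_def v_def
    by (auto intro!: intros simp: fun_eq_iff) algebra
  show "pd 2 (B_r M a) x = 4 * M * a\<^sup>2 * s ^ 4 * (v ^ 3 - 3 * u\<^sup>2 * v)"
    unfolding pd_eqI[OF d] by (simp add: axis_def) algebra
qed

text \<open>
  With \<open>codiv_kerr\<close> and the formulas for the derivatives, both equations multiplied by \<open>q\<^sup>2\<close> are
  polynomial identities in \<open>r, s, c, u, v, a, M\<close> modulo \<open>s\<^sup>2 + c\<^sup>2 = 1\<close> and the two relations between \<open>u\<close> and \<open>v\<close>.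
\<close>

lemma ernst_wave_map:
  defines "ipk \<equiv> ip (kerr_metric M a x)"
  defines "dA \<equiv> differential (ernst_A M a) x" and "dB \<equiv> differential (ernst_B M a) x"
  shows "ernst_A M a x * wave_op (kerr_metric M a) (ernst_A M a) x = ipk dA dA - ipk dB dB"
    and "ernst_A M a x * wave_op (kerr_metric M a) (ernst_B M a) x = 2 * ipk dA dB"
proof -
  define s c r u v where "s = sin (x $ 1)" and "c = cos (x $ 1)" and "r = x $ 2"
    and "u = pot_u a x" and "v = pot_v a x"
  note q = kerr_qq_pos[OF aM x]
  have s: "s \<noteq> 0" using sin_theta_pos[OF aM x] by (simp add: s_def)
  have rel: "s\<^sup>2 = 1 - c\<^sup>2" "r * u + a * c * v = 1" "r * v = a * c * u"
    using pot_relations[OF q] by (simp_all add: s_def c_def r_def u_def v_def sin_squared_eq)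
  have D: "kerr_Delta M a x = r\<^sup>2 + a\<^sup>2 - 2 * M * r" "kerr_rho M x = r - M"
    by (simp_all add: kerr_Delta_def kerr_rho_def r_def)
  have A: "ernst_A M a x = (r\<^sup>2 + a\<^sup>2) * s\<^sup>2 + 2 * M * a\<^sup>2 * s ^ 4 * u"
    using ernst_A_potential[OF q] by (simp add: s_def r_def u_def)
  \<comment> \<open>Splitting off one factor \<open>s\<close> from the \<open>\<theta>\<close>-derivatives cancels the denominator of \<open>cot \<theta>\<close>.\<close>
  define A1 B1 where "A1 = 2 * (r\<^sup>2 + a\<^sup>2) * c + 8 * M * a\<^sup>2 * s\<^sup>2 * c * u + 4 * M * a ^ 3 * s ^ 4 * u * v"
    and "B1 = 6 * a * M * s\<^sup>2 - 8 * M * a\<^sup>2 * s\<^sup>2 * c * v + 2 * M * a ^ 3 * s ^ 4 * (u\<^sup>2 - v\<^sup>2)"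
  have th: "A_theta M a x = s * A1" "B_theta M a x = s * B1"
    unfolding A_theta_def B_theta_def Let_def A1_def B1_def s_def[symmetric] c_def[symmetric]
      r_def[symmetric] u_def[symmetric] v_def[symmetric]
    by algebra+
  have rr: "A_r M a x = 2 * r * s\<^sup>2 + 2 * M * a\<^sup>2 * s ^ 4 * (v\<^sup>2 - u\<^sup>2)" "B_r M a x = 4 * M * a\<^sup>2 * s ^ 4 * u * v"
    by (simp_all add: A_r_def B_r_def Let_def s_def r_def u_def v_def)
  have ipx: "ipk V W = (V $ 1 * W $ 1 + kerr_Delta M a x * (V $ 2 * W $ 2)) / kerr_qq a x"
    if "V $ 3 = 0" "V $ 4 = 0" for V W
    unfolding ipk_def ip_kerr[OF aM x] using that by (simp add: add_divide_distrib)
  have d: "dA $ 1 = s * A1" "dA $ 2 = A_r M a x" "dA $ 3 = 0" "dA $ 4 = 0"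
    "dB $ 1 = s * B1" "dB $ 2 = B_r M a x" "dB $ 3 = 0" "dB $ 4 = 0"
    by (simp_all add: dA_def dB_def differential_def pd_ernst[OF x] th)
  note second = pd_ernst_second[folded s_def c_def r_def u_def v_def]
  have cot: "cos (x $ 1) / sin (x $ 1) * (s * t) = c * t" for t
    using s by (simp add: s_def c_def)
  show "ernst_A M a x * wave_op (kerr_metric M a) (ernst_A M a) x = ipk dA dA - ipk dB dB"
    unfolding ipx[OF d(3,4)] ipx[OF d(7,8)] diff_divide_distrib[symmetric] times_divide_eq_right wave_op_ernst
      d rr th cot second A D
    by (rule arg_cong2[of _ _ _ _ "(/)", OF _ refl], unfold A1_def B1_def) (use rel in algebra)
  show "ernst_A M a x * wave_op (kerr_metric M a) (ernst_B M a) x = 2 * ipk dA dB"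
    unfolding ipx[OF d(3,4)] times_divide_eq_right wave_op_ernst
      d rr th cot second A D
    by (rule arg_cong2[of _ _ _ _ "(/)", OF _ refl], unfold A1_def B1_def) (use rel in algebra)
qed

end
end

section \<open>The Hardy correction\<close>

text \<open>
  The radial variable \<open>\<rho> = r - M\<close> read off from the metric components: their quotient is \<open>\<Delta> = \<rho>\<^sup>2 - (M\<^sup>2 - a\<^sup>2)\<close>.
\<close>

definition hardy_rho :: "real \<Rightarrow> real \<Rightarrow> real^4^4 \<Rightarrow> real" where
  "hardy_rho M a g = sqrt (g $ 1 $ 1 / g $ 2 $ 2 + (M\<^sup>2 - a\<^sup>2))"

text \<open>
  The logarithmic differential of the function \<open>\<rho>\<close> to the power \<open>-1/2\<close>.
\<close>

definition hardy_gauge :: "real \<Rightarrow> real \<Rightarrow> real^4^4 \<Rightarrow> real^4" where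
  "hardy_gauge M a g = axis 2 (- 1 / (2 * hardy_rho M a g))"

text \<open>
  With \<open>b\<^sup>2 = M\<^sup>2 - a\<^sup>2\<close>, the divergence of \<open>hardy_gauge\<close> is the \<open>r\<close>-derivative of
  \<open>- \<Delta> / (2 \<rho>) = - (\<rho> - b\<^sup>2 / \<rho>) / 2\<close>, divided by \<open>q\<^sup>2\<close>.
\<close>

definition hardy_gauge_div :: "real \<Rightarrow> real \<Rightarrow> real^4^4 \<Rightarrow> real" where
  "hardy_gauge_div M a g = - (1 + (M\<^sup>2 - a\<^sup>2) / (hardy_rho M a g)\<^sup>2) / (2 * g $ 1 $ 1)"

text \<open>
  The quantity \<open>\<Delta> q\<^sup>2 |S|\<^sup>2\<close>, where \<open>S\<close> is the form \<open>hardy_remainder\<close> and \<open>|S|\<^sup>2 = - (div K + |K|\<^sup>2)\<close>. For the form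
  \<open>\<sigma>(r) dr\<close> the product \<open>\<Delta> \<sigma>\<close> is the square root of this weight, so the divergence of \<open>S\<close> is the derivative of
  that root divided by \<open>q\<^sup>2\<close> (\<open>hardy_remainder_div\<close>).
\<close>

definition hardy_weight :: "real \<Rightarrow> real \<Rightarrow> real" where
  "hardy_weight b2 \<rho> = \<rho>\<^sup>2 / 4 + b2 / 2 - 3 * b2\<^sup>2 / (4 * \<rho>\<^sup>2)"

definition hardy_remainder :: "real \<Rightarrow> real \<Rightarrow> real^4^4 \<Rightarrow> real^4" where
  "hardy_remainder M a g = axis 2 (sqrt (hardy_weight (M\<^sup>2 - a\<^sup>2) (hardy_rho M a g)) / (g $ 1 $ 1 / g $ 2 $ 2))"

definition hardy_remainder_div :: "real \<Rightarrow> real \<Rightarrow> real^4^4 \<Rightarrow> real" where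
  "hardy_remainder_div M a g = (let \<rho> = hardy_rho M a g; b2 = M\<^sup>2 - a\<^sup>2 in
     (\<rho> / 2 + 3 * b2\<^sup>2 / (2 * \<rho> ^ 3)) / (2 * sqrt (hardy_weight b2 \<rho>)) / g $ 1 $ 1)"

lemma hardy_weight_factored:
  assumes "\<rho> \<noteq> 0"
  shows "hardy_weight b2 \<rho> = (\<rho>\<^sup>2 - b2) * (\<rho>\<^sup>2 + 3 * b2) / (4 * \<rho>\<^sup>2)"
  using assms by (simp add: hardy_weight_def field_simps power2_eq_square)

context
  fixes M a :: real
  assumes aM: "\<bar>a\<bar> \<le> M"
begin

lemma kerr_recover:
  assumes x: "x \<in> kerr_exterior M a"
  shows "kerr_metric M a x $ 1 $ 1 / kerr_metric M a x $ 2 $ 2 = kerr_Delta M a x"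
    and "hardy_rho M a (kerr_metric M a x) = kerr_rho M x"
proof -
  show D: "kerr_metric M a x $ 1 $ 1 / kerr_metric M a x $ 2 $ 2 = kerr_Delta M a x"
    using kerr_qq_pos[OF aM x] by (simp add: kerr_metric_entries)
  show "hardy_rho M a (kerr_metric M a x) = kerr_rho M x"
    using kerr_rho_pos[OF aM x] unfolding hardy_rho_def D kerr_Delta_eq_rho by simp
qed

lemma hardy_weight_pos:
  assumes x: "x \<in> kerr_exterior M a"
  shows "hardy_weight (M\<^sup>2 - a\<^sup>2) (kerr_rho M x) > 0"
proof -
  have r: "kerr_rho M x > 0" by (rule kerr_rho_pos[OF aM x])
  have "(kerr_rho M x)\<^sup>2 - (M\<^sup>2 - a\<^sup>2) > 0" using kerr_Delta_pos[OF aM x] by (simp add: kerr_Delta_eq_rho)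
  moreover have "(kerr_rho M x)\<^sup>2 + 3 * (M\<^sup>2 - a\<^sup>2) > 0"
    using mass_dominates_spin[OF aM] r by (intro add_pos_nonneg) auto
  ultimately show ?thesis using r hardy_weight_factored[of "kerr_rho M x" "M\<^sup>2 - a\<^sup>2"] by simp
qed

context
  fixes x
  assumes x: "x \<in> kerr_exterior M a"
begin

text \<open>
  Forms \<open>f(\<rho>) dr\<close> are closed, and their divergence is the \<open>r\<close>-derivative of \<open>\<Delta> f\<close> divided by \<open>q\<^sup>2\<close>. The equation
  for \<open>V\<close> is assumed in the exterior only, where \<open>\<rho>\<close> can be recovered from the metric.
\<close>

lemma radial_covector:
  assumes V: "\<And>y. y \<in> kerr_exterior M a \<Longrightarrow> V y = axis 2 (f (kerr_rho M y))"
    and f: "(f has_real_derivative f') (at (kerr_rho M x))"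
  shows "V differentiable (at x)" "ext_deriv V x = 0"
    "codiv (kerr_metric M a) V x = (kerr_Delta M a x * f' + 2 * kerr_rho M x * f (kerr_rho M x)) / kerr_qq a x"
proof -
  have "(kerr_rho M has_derivative (\<lambda>h. h $ 2)) (at x)"
    unfolding kerr_rho_def[abs_def] by (auto intro!: derivative_eq_intros has_derivative_coord)
  from diff_chain_at[OF this f[unfolded has_field_derivative_def]]
  have df: "((\<lambda>y. f (kerr_rho M y)) has_derivative (\<lambda>h. f' * h $ 2)) (at x)"
    by (simp add: o_def)
  have comp: "\<forall>\<^sub>F y in nhds x. (if j = 2 then f (kerr_rho M y) else 0) = V y $ j" for j
    using near_exterior[OF x] by eventually_elim (simp add: V axis_def)
  have d: "(\<lambda>y. if j = 2 then f (kerr_rho M y) else 0) differentiable (at x)" for j :: 4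
    using df by (cases "j = 2") (auto simp: differentiable_def)
  show "V differentiable (at x)"
    by (rule differentiable_vecI, rule differentiable_cong_nhds[OF comp d])
  have pdV: "pd i (\<lambda>y. V y $ j) x = (if i = 2 \<and> j = 2 then f' else 0)" for i j
    using pd_cong[OF comp[of j], of i] pd_eqI[OF df, of i] by (cases "j = 2") (auto simp: axis_def)
  show "ext_deriv V x = 0"
    by (simp add: ext_deriv_def vec_eq_iff pdV)
  have "\<forall>\<^sub>F y in nhds x. V y $ 3 = 0 \<and> V y $ 4 = 0"
    using near_exterior[OF x] by eventually_elim (simp add: V axis_def)
  from codiv_kerr[OF aM x this]
  show "codiv (kerr_metric M a) V x = (kerr_Delta M a x * f' + 2 * kerr_rho M x * f (kerr_rho M x)) / kerr_qq a x"
    by (simp add: pdV V[OF x] axis_def)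
qed

lemma hardy_gauge_kerr:
  "(\<lambda>y. hardy_gauge M a (kerr_metric M a y)) differentiable (at x)"
  "ext_deriv (\<lambda>y. hardy_gauge M a (kerr_metric M a y)) x = 0"
  "codiv (kerr_metric M a) (\<lambda>y. hardy_gauge M a (kerr_metric M a y)) x = hardy_gauge_div M a (kerr_metric M a x)"
proof -
  have r: "kerr_rho M x > 0" by (rule kerr_rho_pos[OF aM x])
  have V: "hardy_gauge M a (kerr_metric M a y) = axis 2 (- 1 / (2 * kerr_rho M y))" if "y \<in> kerr_exterior M a" for y
    by (simp add: hardy_gauge_def kerr_recover(2)[OF that])
  have f: "((\<lambda>\<rho>. - 1 / (2 * \<rho>)) has_real_derivative 1 / (2 * (kerr_rho M x)\<^sup>2)) (at (kerr_rho M x))"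
    using r by (auto intro!: derivative_eq_intros simp: field_simps power2_eq_square)
  show "(\<lambda>y. hardy_gauge M a (kerr_metric M a y)) differentiable (at x)"
    "ext_deriv (\<lambda>y. hardy_gauge M a (kerr_metric M a y)) x = 0"
    using radial_covector(1,2)[OF V f] by blast+
  have "codiv (kerr_metric M a) (\<lambda>y. hardy_gauge M a (kerr_metric M a y)) x = (kerr_Delta M a x *
      (1 / (2 * (kerr_rho M x)\<^sup>2)) + 2 * kerr_rho M x * (- 1 / (2 * kerr_rho M x))) / kerr_qq a x"
    by (rule radial_covector(3)[OF _ f]) (rule V)
  then show "codiv (kerr_metric M a) (\<lambda>y. hardy_gauge M a (kerr_metric M a y)) x = hardy_gauge_div M a (kerr_metric M a x)"
    unfolding hardy_gauge_div_def kerr_recover(2)[OF x] kerr_metric_entries kerr_Delta_eq_rho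
    using r kerr_qq_pos[OF aM x] by (simp add: field_simps power2_eq_square)
qed

lemma hardy_remainder_kerr:
  "(\<lambda>y. hardy_remainder M a (kerr_metric M a y)) differentiable (at x)"
  "ext_deriv (\<lambda>y. hardy_remainder M a (kerr_metric M a y)) x = 0"
  "codiv (kerr_metric M a) (\<lambda>y. hardy_remainder M a (kerr_metric M a y)) x = hardy_remainder_div M a (kerr_metric M a x)"
proof -
  define b2 where "b2 = M\<^sup>2 - a\<^sup>2"
  define \<rho> where "\<rho> = kerr_rho M x"
  have r: "\<rho> > 0" unfolding \<rho>_def by (rule kerr_rho_pos[OF aM x])
  have D: "kerr_Delta M a y = (kerr_rho M y)\<^sup>2 - b2" for y by (simp add: kerr_Delta_eq_rho b2_def)
  have D0: "\<rho>\<^sup>2 - b2 > 0" using kerr_Delta_pos[OF aM x] by (simp add: D \<rho>_def)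
  define w where "w = hardy_weight b2 \<rho>"
  have w: "w > 0" using hardy_weight_pos[OF x] by (simp add: w_def b2_def \<rho>_def)
  let ?f = "\<lambda>t. sqrt (hardy_weight b2 t) / (t\<^sup>2 - b2)"
  let ?w' = "\<rho> / 2 + 3 * b2\<^sup>2 / (2 * \<rho> ^ 3)"
  have V: "hardy_remainder M a (kerr_metric M a y) = axis 2 (?f (kerr_rho M y))" if "y \<in> kerr_exterior M a" for y
    unfolding hardy_remainder_def kerr_recover[OF that] D b2_def[symmetric] ..
  have dw: "(hardy_weight b2 has_real_derivative ?w') (at \<rho>)"
    unfolding hardy_weight_def[abs_def] using r
    by (auto intro!: derivative_eq_intros simp: field_simps power2_eq_square power3_eq_cube)
  have "((\<lambda>t. sqrt (hardy_weight b2 t)) has_real_derivative ?w' * (inverse (sqrt w) / 2)) (at \<rho>)"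
    using DERIV_chain2[OF DERIV_real_sqrt[OF w[unfolded w_def]] dw] by (simp add: w_def mult.commute)
  moreover have "((\<lambda>t. t\<^sup>2 - b2) has_real_derivative 2 * \<rho>) (at \<rho>)"
    by (auto intro!: derivative_eq_intros)
  ultimately have "(?f has_real_derivative
      (?w' * (inverse (sqrt w) / 2) * (\<rho>\<^sup>2 - b2) - sqrt w * (2 * \<rho>)) / ((\<rho>\<^sup>2 - b2) * (\<rho>\<^sup>2 - b2))) (at \<rho>)"
    using D0 unfolding w_def by (intro DERIV_divide) auto
  note f = this[unfolded \<rho>_def]
  show "(\<lambda>y. hardy_remainder M a (kerr_metric M a y)) differentiable (at x)"
    "ext_deriv (\<lambda>y. hardy_remainder M a (kerr_metric M a y)) x = 0"
    using radial_covector(1,2)[OF V f] by blast+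
  have alg: "d * ((p * (inverse t / 2) * d - t * e) / (d * d)) + e * (t / d) = p / (2 * t)"
    if "d > 0" "t > 0" for d p t e :: real
    using that by (simp add: field_simps)
  let ?f' = "(?w' * (inverse (sqrt w) / 2) * (\<rho>\<^sup>2 - b2) - sqrt w * (2 * \<rho>)) / ((\<rho>\<^sup>2 - b2) * (\<rho>\<^sup>2 - b2))"
  have codiv: "codiv (kerr_metric M a) (\<lambda>y. hardy_remainder M a (kerr_metric M a y)) x =
      (kerr_Delta M a x * ?f' + 2 * \<rho> * ?f \<rho>) / kerr_qq a x"
    unfolding \<rho>_def by (rule radial_covector(3)[OF _ f]) (rule V)
  show "codiv (kerr_metric M a) (\<lambda>y. hardy_remainder M a (kerr_metric M a y)) x = hardy_remainder_div M a (kerr_metric M a x)"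
    unfolding codiv hardy_remainder_div_def Let_def kerr_recover(2)[OF x] kerr_metric_entries D
      \<rho>_def[symmetric] b2_def[symmetric] w_def[symmetric]
    unfolding alg[OF D0 real_sqrt_gt_zero[OF w]] ..
qed

text \<open>
  Multiplied by \<open>q\<^sup>2\<close>, the three terms are \<open>- (1 + b\<^sup>2/\<rho>\<^sup>2) / 2\<close>, \<open>(1 - b\<^sup>2/\<rho>\<^sup>2) / 4\<close> and \<open>(1 + 3 b\<^sup>2/\<rho>\<^sup>2) / 4\<close>.
\<close>

lemma hardy_riccati:
  defines "g \<equiv> kerr_metric M a x"
  shows "hardy_gauge_div M a g + ip g (hardy_gauge M a g) (hardy_gauge M a g) + ip g (hardy_remainder M a g) (hardy_remainder M a g) = 0"
proof -
  define b2 \<rho> q where "b2 = M\<^sup>2 - a\<^sup>2" and "\<rho> = kerr_rho M x" and "q = kerr_qq a x"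
  have r: "\<rho> > 0" unfolding \<rho>_def by (rule kerr_rho_pos[OF aM x])
  have q: "q > 0" unfolding q_def by (rule kerr_qq_pos[OF aM x])
  have D: "kerr_Delta M a x = \<rho>\<^sup>2 - b2" by (simp add: kerr_Delta_eq_rho b2_def \<rho>_def)
  have D0: "\<rho>\<^sup>2 - b2 > 0" using kerr_Delta_pos[OF aM x] by (simp add: D)
  have w: "hardy_weight b2 \<rho> > 0" using hardy_weight_pos[OF x] by (simp add: b2_def \<rho>_def)
  have "ip g (hardy_gauge M a g) (hardy_gauge M a g) = (\<rho>\<^sup>2 - b2) / (4 * \<rho>\<^sup>2 * q)"
    unfolding g_def ip_kerr[OF aM x] hardy_gauge_def kerr_recover[OF x] D \<rho>_def[symmetric] q_def[symmetric]
    by (simp add: axis_def power2_eq_square)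
  moreover have "ip g (hardy_remainder M a g) (hardy_remainder M a g) = (\<rho>\<^sup>2 + 3 * b2) / (4 * \<rho>\<^sup>2 * q)"
  proof -
    have *: "d * (t / d * (t / d)) = t\<^sup>2 / d" if "d > 0" for d t :: real
      using that by (simp add: power2_eq_square)
    have "(\<rho>\<^sup>2 - b2) * (sqrt (hardy_weight b2 \<rho>) / (\<rho>\<^sup>2 - b2) * (sqrt (hardy_weight b2 \<rho>) / (\<rho>\<^sup>2 - b2)))
        = hardy_weight b2 \<rho> / (\<rho>\<^sup>2 - b2)"
      unfolding *[OF D0] using w by simp
    also have "\<dots> = (\<rho>\<^sup>2 + 3 * b2) / (4 * \<rho>\<^sup>2)"
      unfolding hardy_weight_factored[OF less_imp_neq[OF r, symmetric]] using D0 by simp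
    finally show ?thesis
      unfolding g_def ip_kerr[OF aM x] hardy_remainder_def kerr_recover[OF x] D \<rho>_def[symmetric] q_def[symmetric] b2_def[symmetric]
      by (simp add: axis_def)
  qed
  moreover have "hardy_gauge_div M a g = - (1 + b2 / \<rho>\<^sup>2) / (2 * q)"
    by (simp add: g_def hardy_gauge_div_def kerr_recover[OF x] kerr_metric_entries \<rho>_def q_def b2_def)
  moreover have "- (1 + b2 / \<rho>\<^sup>2) / (2 * q) + (\<rho>\<^sup>2 - b2) / (4 * \<rho>\<^sup>2 * q) + (\<rho>\<^sup>2 + 3 * b2) / (4 * \<rho>\<^sup>2 * q) = 0"
    using r q by (simp add: field_simps)
  ultimately show ?thesis by (simp only:)
qed

lemma hardy_remainder_nonzero: "hardy_remainder M a (kerr_metric M a x) \<noteq> 0"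
  using hardy_weight_pos[OF x] kerr_Delta_pos[OF aM x]
  by (simp add: hardy_remainder_def kerr_recover[OF x] axis_eq_0_iff)

section \<open>Positivity and the conclusion\<close>

lemma stress_form_kerr:
  "X \<bullet> (stress (kerr_metric M a x) V *v Y) =
    (V \<bullet> X) * (V \<bullet> Y) - kerr_form M a x X Y * ip (kerr_metric M a x) V V / 2"
proof -
  have "X \<bullet> (stress g V *v Y) = (V \<bullet> X) * (V \<bullet> Y) - (X \<bullet> (g *v Y)) * ip g V V / 2" for g
    by (simp add: stress_def inner_vec_def matrix_vector_mult_def sum_4 algebra_simps
        add_divide_distrib diff_divide_distrib)
  then show ?thesis by (simp add: kerr_form_eq_metric)
qed

text \<open>
  In the orthonormal frame of the observers orthogonal to the level sets of \<open>t\<close>, with spatial components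
  \<open>sp\<close>, this is the Minkowski statement. The future is the side where \<open>t\<close> increases, which is the time
  direction of this frame.
\<close>

lemma stress_kerr_positive:
  assumes X: "future_timelike M a x X" and Y: "future_timelike M a x Y" and V: "V \<noteq> 0"
  shows "X \<bullet> (stress (kerr_metric M a x) V *v Y) > 0"
proof -
  let ?N = "sqrt (lapse_sq M a x)" and ?q = "sqrt (kerr_qq a x)" and ?e = "sqrt (kerr_qq a x / kerr_Delta M a x)"
    and ?A = "sqrt (ernst_A M a x)" and ?w = "frame_dragging M a x"
  have pos: "lapse_sq M a x > 0" "kerr_qq a x > 0" "kerr_Delta M a x > 0" "ernst_A M a x > 0"
    using lapse_sq_pos[OF aM x] kerr_qq_pos[OF aM x] kerr_Delta_pos[OF aM x] ernst_A_pos[OF aM x] .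
  define sp :: "real^4 \<Rightarrow> real \<times> real \<times> real" where
    "sp W = (?q * W $ 1, ?e * W $ 2, ?A * (W $ 4 - ?w * W $ 3))" for W
  define v :: "real \<times> real \<times> real" where "v = (V $ 1 / ?q, V $ 2 / ?e, V $ 4 / ?A)"
  define v0 where "v0 = (V $ 3 + ?w * V $ 4) / ?N"
  have form: "kerr_form M a x W W' = sp W \<bullet> sp W' - (?N * W $ 3) * (?N * W' $ 3)" for W W'
  proof -
    have "(sqrt t * b) * (sqrt t * c) = t * (b * c)" if "t > 0" for b c t :: real
      using that by (simp add: algebra_simps)
    note sq = this[OF pos(1)] this[OF pos(2)] this[OF pos(4)] this[OF divide_pos_pos[OF pos(2,3)]]
    show ?thesis unfolding kerr_form_eq sp_def by (simp add: sq)
  qed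
  have fut: "norm (sp W) < ?N * W $ 3" if "future_timelike M a x W" for W
  proof -
    have "sp W \<bullet> sp W < (?N * W $ 3)\<^sup>2" "0 < ?N * W $ 3"
      using that pos unfolding future_timelike_def form by (auto simp: power2_eq_square)
    then show ?thesis
      by (metis power2_norm_eq_inner power_less_imp_less_base less_imp_le)
  qed
  have pair: "V \<bullet> W = v0 * (?N * W $ 3) + v \<bullet> sp W" for W
    unfolding v0_def v_def sp_def using pos
    by simp (simp add: inner_vec_def sum_4 algebra_simps)
  have sqr: "ip (kerr_metric M a x) V V = v \<bullet> v - v0\<^sup>2"
    unfolding ip_kerr[OF aM x] v_def v0_def using pos by (simp add: power2_eq_square)
  have "v0 \<noteq> 0 \<or> v \<noteq> 0"
  proof (rule ccontr)
    assume "\<not> ?thesis"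
    then have "V $ 1 = 0 \<and> V $ 2 = 0 \<and> V $ 3 = 0 \<and> V $ 4 = 0"
      using pos by (auto simp: v0_def v_def zero_prod_def)
    then show False using V by (simp add: vec_eq_iff forall_4)
  qed
  from lorentz_dominant_energy[OF fut[OF X] fut[OF Y] this]
  show ?thesis unfolding stress_form_kerr pair sqr form .
qed

end
end

lemma transpose_energy_tensor:
  assumes "transpose g = g"
  shows "transpose (energy_tensor g K S p v) = energy_tensor g K S p v"
proof -
  have "g $ i $ j = g $ j $ i" for i j
    using arg_cong[OF assms, of "\<lambda>m. m $ j $ i"] by (simp add: transpose_def)
  then show ?thesis
    by (simp add: energy_tensor_def stress_def transpose_def vec_eq_iff mult.commute)
qed

theorem theorem1p3:
  fixes M a :: real
  assumes "\<bar>a\<bar> \<le> M"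
  shows "\<exists>(Q :: real^4^4 \<Rightarrow> jet \<Rightarrow> jet \<Rightarrow> real^4^4) (J :: real^4^4 \<Rightarrow> jet \<Rightarrow> jet \<Rightarrow> real^4).
    (\<forall>g p. quadratic (Q g p) \<and> quadratic (J g p)) \<and>
    (\<forall>U \<phi> \<psi>. open U \<and> U \<subseteq> kerr_exterior M a \<and> axisymmetric_solution M a U \<phi> \<psi> \<longrightarrow>
      (let \<Phi> = jet1 (ernst_A M a) (ernst_B M a);
           \<Psi> = jet1 \<phi> \<psi>;
           QQ = (\<lambda>x. Q (kerr_metric M a x) (\<Phi> x) (\<Psi> x));
           JJ = (\<lambda>x. J (kerr_metric M a x) (\<Phi> x) (\<Psi> x))
       in \<forall>x\<in>U.
         transpose (QQ x) = QQ x \<and>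
         (\<forall>X Y. future_timelike M a x X \<and> future_timelike M a x Y \<and> \<Psi> x \<noteq> 0 \<longrightarrow>
            X \<bullet> (QQ x *v Y) > 0) \<and>
         QQ differentiable (at x) \<and>
         divergence (kerr_metric M a) QQ x = JJ x \<and>
         T_vec \<bullet> JJ x = 0 \<and>
         (\<forall>X. kerr_form M a x Z_vec X = 0 \<longrightarrow> Z_vec \<bullet> (QQ x *v X) = 0)))"
proof -
  let ?Q = "\<lambda>g. energy_tensor g (hardy_gauge M a g) (hardy_remainder M a g)"
  let ?J = "\<lambda>g. energy_source g (hardy_gauge M a g) (hardy_gauge_div M a g) (hardy_remainder M a g) (hardy_remainder_div M a g)"
  let ?A = "ernst_A M a" and ?B = "ernst_B M a" and ?g = "kerr_metric M a"
  note aM = assms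
  have main: "transpose (?Q (?g x) (jet1 ?A ?B x) (jet1 \<phi> \<psi> x)) = ?Q (?g x) (jet1 ?A ?B x) (jet1 \<phi> \<psi> x)
      \<and> (\<forall>X Y. future_timelike M a x X \<and> future_timelike M a x Y \<and> jet1 \<phi> \<psi> x \<noteq> 0 \<longrightarrow>
          X \<bullet> (?Q (?g x) (jet1 ?A ?B x) (jet1 \<phi> \<psi> x) *v Y) > 0)
      \<and> (\<lambda>x. ?Q (?g x) (jet1 ?A ?B x) (jet1 \<phi> \<psi> x)) differentiable (at x)
      \<and> divergence ?g (\<lambda>x. ?Q (?g x) (jet1 ?A ?B x) (jet1 \<phi> \<psi> x)) x = ?J (?g x) (jet1 ?A ?B x) (jet1 \<phi> \<psi> x)
      \<and> T_vec \<bullet> ?J (?g x) (jet1 ?A ?B x) (jet1 \<phi> \<psi> x) = 0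
      \<and> (\<forall>X. kerr_form M a x Z_vec X = 0 \<longrightarrow>
          Z_vec \<bullet> (?Q (?g x) (jet1 ?A ?B x) (jet1 \<phi> \<psi> x) *v X) = 0)"
    if U: "open U" "U \<subseteq> kerr_exterior M a" and sol: "axisymmetric_solution M a U \<phi> \<psi>" and xU: "x \<in> U"
    for U \<phi> \<psi> x
  proof -
    have x: "x \<in> kerr_exterior M a" using U xU by auto
    interpret metric_at ?g x by (rule metric_at_kerr[OF aM x])
    let ?K = "hardy_gauge M a (?g x)" and ?S = "hardy_remainder M a (?g x)"
    define p v where "p = jet1 ?A ?B x" and "v = jet1 \<phi> \<psi> x"
    have lin: "linearized_equations ?g ?A ?B \<phi> \<psi> x"
      and axi: "differential \<phi> x $ 4 = 0" "differential \<psi> x $ 4 = 0"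
      using sol xU unfolding axisymmetric_solution_def
      by (auto simp: Z_vec_def inner_axis inner_commute)
    have reg1: "f differentiable (at y)" if "f \<in> {?A, ?B, \<phi>, \<psi>}" "y \<in> U" for f y
      using that sol U differentiable_kerr(6,7)[OF aM, of y]
      unfolding axisymmetric_solution_def C2_on_def by auto
    have reg2: "pd i f differentiable (at x)" if "f \<in> {?A, ?B, \<phi>, \<psi>}" for f i
      using that sol xU differentiable_pd_ernst[OF aM x]
      unfolding axisymmetric_solution_def C2_on_def by auto
    have A0: "?A y \<noteq> 0" if "y \<in> U" for y
      using ernst_A_pos[OF aM, of y] U that by auto
    note div = divergence_energy_tensor[OF U(1) xU reg1 reg2 A0 ernst_wave_map[OF aM x] lin
        hardy_gauge_kerr(1,2)[OF aM x] hardy_remainder_kerr(1,2)[OF aM x],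
        unfolded hardy_gauge_kerr(3)[OF aM x] hardy_remainder_kerr(3)[OF aM x]]
    have dAB: "fst (snd p) $ 3 = 0" "snd (snd p) $ 3 = 0" "fst (snd p) $ 4 = 0" "snd (snd p) $ 4 = 0"
      by (simp_all add: p_def jet1_def differential_def pd_ernst[OF aM x])
    have axi_v: "fst (snd v) $ 4 = 0" "snd (snd v) $ 4 = 0"
      using axi by (simp_all add: v_def jet1_def)
    have sym: "transpose (?g x) = ?g x"
      using g_sym by (simp add: transpose_def vec_eq_iff)
    have T3: "T_vec \<bullet> V = V $ 3" and Z4: "V \<bullet> Z_vec = V $ 4" for V
      by (simp_all add: T_vec_def Z_vec_def inner_axis inner_axis')
    have T: "T_vec \<bullet> ?J (?g x) p v = 0"
      by (rule energy_source_orthogonal[OF ip_commute _ _ _ _ hardy_riccati[OF aM x]])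
        (simp_all add: T3 log_form_def twist_form_def dAB hardy_gauge_def hardy_remainder_def, simp_all add: axis_def)
    let ?forms = "{E_form ?K p v, F_form ?K p v, N_form p v, fst (fst v) *\<^sub>R ?S, snd (fst v) *\<^sub>R ?S}"
    have split: "X \<bullet> (?Q (?g x) p v *v Y) =
        X \<bullet> (stress (?g x) (E_form ?K p v) *v Y) + X \<bullet> (stress (?g x) (F_form ?K p v) *v Y)
        + X \<bullet> (stress (?g x) (N_form p v) *v Y) + X \<bullet> (stress (?g x) (fst (fst v) *\<^sub>R ?S) *v Y)
        + X \<bullet> (stress (?g x) (snd (fst v) *\<^sub>R ?S) *v Y)" for X Y
      by (simp add: energy_tensor_def matrix_vector_mult_add_rdistrib inner_add_right)
    have pos: "X \<bullet> (?Q (?g x) p v *v Y) > 0"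
      if X: "future_timelike M a x X" and Y: "future_timelike M a x Y" and v0: "v \<noteq> 0" for X Y
    proof -
      have gt: "X \<bullet> (stress (?g x) V *v Y) > 0" if "V \<noteq> 0" for V
        using stress_kerr_positive[OF aM x X Y that] .
      have "X \<bullet> (stress (?g x) 0 *v Y) = 0"
        by (simp add: stress_form_kerr[OF aM x] ip_def)
      then have ge: "X \<bullet> (stress (?g x) V *v Y) \<ge> 0" for V
        using gt[of V] by (cases "V = 0") simp_all
      \<comment> \<open>If \<open>\<phi>\<close> or \<open>\<psi>\<close> is nonzero, so is \<open>\<phi> S\<close> or \<open>\<psi> S\<close>; otherwise \<open>E = d\<phi>\<close> and \<open>F = d\<psi>\<close>.\<close>
      have "\<exists>V\<in>?forms. V \<noteq> 0"
      proof (cases "fst v = 0")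
        case True
        then have "fst (snd v) \<noteq> 0 \<or> snd (snd v) \<noteq> 0" using v0 by (metis prod.collapse zero_prod_def)
        then show ?thesis using True by (auto simp: E_form_def F_form_def)
      next
        case False
        then have "fst (fst v) \<noteq> 0 \<or> snd (fst v) \<noteq> 0" by (metis prod.collapse zero_prod_def)
        then show ?thesis using hardy_remainder_nonzero[OF aM x] by auto
      qed
      then show ?thesis
        unfolding split
        using gt[of "E_form ?K p v"] gt[of "F_form ?K p v"] gt[of "N_form p v"]
          gt[of "fst (fst v) *\<^sub>R ?S"] gt[of "snd (fst v) *\<^sub>R ?S"]
          ge[of "E_form ?K p v"] ge[of "F_form ?K p v"] ge[of "N_form p v"]
          ge[of "fst (fst v) *\<^sub>R ?S"] ge[of "snd (fst v) *\<^sub>R ?S"]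
        by (auto simp del: scaleR_eq_0_iff)
    qed
    have Z: "Z_vec \<bullet> (?Q (?g x) p v *v X) = 0" if "kerr_form M a x Z_vec X = 0" for X
    proof -
      have "V \<bullet> Z_vec = 0" if "V \<in> ?forms" for V
        using that unfolding Z4 by (auto simp: E_form_def F_form_def N_form_def log_form_def
            twist_form_def dAB axi_v hardy_gauge_def hardy_remainder_def axis_def)
      then have zero: "Z_vec \<bullet> (stress (?g x) V *v X) = 0" if "V \<in> ?forms" for V
        unfolding stress_form_kerr[OF aM x] using that \<open>kerr_form M a x Z_vec X = 0\<close> by simp
      show ?thesis
        unfolding split
        using zero[of "E_form ?K p v"] zero[of "F_form ?K p v"] zero[of "N_form p v"]
          zero[of "fst (fst v) *\<^sub>R ?S"] zero[of "snd (fst v) *\<^sub>R ?S"]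
        by simp
    qed
    show ?thesis
      using transpose_energy_tensor[OF sym] pos div T Z unfolding p_def v_def
      by (intro conjI allI impI) simp_all
  qed
  show ?thesis
  proof (rule exI[of _ ?Q], rule exI[of _ ?J], intro conjI allI impI)
    show "quadratic (?Q g p)" "quadratic (?J g p)" for g p
      by (rule quadratic_energy_tensor quadratic_energy_source)+
  next
    fix U \<phi> \<psi>
    assume "open U \<and> U \<subseteq> kerr_exterior M a \<and> axisymmetric_solution M a U \<phi> \<psi>"
    then show "let \<Phi> = jet1 ?A ?B; \<Psi> = jet1 \<phi> \<psi>; QQ = (\<lambda>x. ?Q (?g x) (\<Phi> x) (\<Psi> x));
        JJ = (\<lambda>x. ?J (?g x) (\<Phi> x) (\<Psi> x))
      in \<forall>x\<in>U. transpose (QQ x) = QQ x \<and>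
         (\<forall>X Y. future_timelike M a x X \<and> future_timelike M a x Y \<and> \<Psi> x \<noteq> 0 \<longrightarrow>
            X \<bullet> (QQ x *v Y) > 0) \<and>
         QQ differentiable (at x) \<and> divergence ?g QQ x = JJ x \<and> T_vec \<bullet> JJ x = 0 \<and>
         (\<forall>X. kerr_form M a x Z_vec X = 0 \<longrightarrow> Z_vec \<bullet> (QQ x *v X) = 0)"
      unfolding Let_def by (intro ballI, elim conjE) (rule main)
  qed
qed
end
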